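(* Let $a,b>0$ with $ab<1$, and let $f\in L^2(\mathbb R)$ be such that the Gabor system $\{E_{mb}\mathcal T_{na}f\}_{m,n\in\mathbb Z}$ is a tight frame for $L^2(\mathbb R)$. Then the adjoint system $\left\{\frac{1}{\sqrt{ab}}E_{\frac ma}\mathcal T_{\frac nb}f\right\}_{m,n\in\mathbb Z}$ is a weak R-dual of $\{E_{mb}\mathcal T_{na}f\}_{m,n\in\mathbb Z}$ with respect to an orthonormal basis $u$ of $L^2(\mathbb R)$ and a Parseval frame $v$ for $L^2(\mathbb R)$ which is not an orthonormal basis.
   Context: For $x\in\mathbb R$, $(E_xg)(t)=e^{2\pi ixt}g(t)$ and $(\mathcal T_xg)(t)=g(t-x)$ on $L^2(\mathbb R)$. All sequences here are indexed by $I=\mathbb Z\times\mathbb Z$. Inner products are linear in the first variable. A sequence $\{f_i\}_{i\in I}$ in a Hilbert space $H$ is a tight frame for $H$ if there is $0<A<\infty$ with $\sum_{i}|\langle x,f_i\rangle|^2=A\|x\|^2$ for all $x\in H$; it is a Parseval frame if $A=1$. Weak R-dual: let $u=\{u_i\}_{i\in I},v=\{v_i\}_{i\in I}$ be Parseval frames for $H$ and $f=\{f_i\}_{i\in I}$ a sequence in $H$ such that $\sum_{i\in I}|\langle f_i,u_j\rangle|^2<\infty$ for all $j\in I$ and $\sum_{k\in I}\langle v_k,v_i\rangle\langle f_k,u_j\rangle=\langle f_i,u_j\rangle$ for all $i,j\in I$. Then $w=\{w_j\}_{j\in I}$ given by $w_j=\sum_{i\in I}\langle f_i,u_j\rangle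 v_i$ is called the weak R-dual of $f$ with respect to $u$ and $v$ (first $u$, then $v$). *)

theory Defs
  imports "HOL-Analysis.Analysis"
begin

section \<open>Complex Hilbert spaces\<close>

text \<open>The complex inner product is linear in its first argument. Norm, topology and infinite sums
  are those of the underlying real inner product space, whose inner product is the real part of the
  complex one.\<close>

class complex_inner = real_inner +
  fixes scaleC :: "complex \<Rightarrow> 'a \<Rightarrow> 'a" (infixr "*\<^sub>C" 75)
    and cinner :: "'a \<Rightarrow> 'a \<Rightarrow> complex"
  assumes scaleC_add_right: "c *\<^sub>C (x + y) = c *\<^sub>C x + c *\<^sub>C y"
    and scaleC_add_left: "(c + d) *\<^sub>C x = c *\<^sub>C x + d *\<^sub>C x"
    and scaleC_scaleC: "c *\<^sub>C d *\<^sub>C x = (c * d) *\<^sub>C x"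
    and scaleR_scaleC: "r *\<^sub>R x = complex_of_real r *\<^sub>C x"
    and cinner_commute: "cinner x y = cnj (cinner y x)"
    and cinner_add_left: "cinner (x + y) z = cinner x z + cinner y z"
    and cinner_scaleC_left: "cinner (c *\<^sub>C x) y = c * cinner x y"
    and inner_eq_Re_cinner: "inner x y = Re (cinner x y)"

class complex_hilbert = complex_inner + complete_space


section \<open>Frames, orthonormal bases and weak R-duals\<close>

text \<open>Sums over index sets are unconditional sums (\<open>has_sum\<close>).\<close>

definition tight_frame_bound :: "real \<Rightarrow> ('i \<Rightarrow> 'a::complex_hilbert) \<Rightarrow> bool" where
  "tight_frame_bound A f \<longleftrightarrow>
     A > 0 \<and> (\<forall>x. ((\<lambda>i. (cmod (cinner x (f i)))\<^sup>2) has_sum A * (norm x)\<^sup>2) UNIV)"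

definition tight_frame :: "('i \<Rightarrow> 'a::complex_hilbert) \<Rightarrow> bool" where
  "tight_frame f \<longleftrightarrow> (\<exists>A. tight_frame_bound A f)"

definition parseval_frame :: "('i \<Rightarrow> 'a::complex_hilbert) \<Rightarrow> bool" where
  "parseval_frame f \<longleftrightarrow> tight_frame_bound 1 f"

definition orthonormal_family :: "('i \<Rightarrow> 'a::complex_hilbert) \<Rightarrow> bool" where
  "orthonormal_family e \<longleftrightarrow> (\<forall>i j. cinner (e i) (e j) = (if i = j then 1 else 0))"

definition complex_span :: "('i \<Rightarrow> 'a::complex_hilbert) \<Rightarrow> 'a set" where
  "complex_span e = {\<Sum>i\<in>F. c i *\<^sub>C e i | F c. finite F}"

definition orthonormal_basis :: "('i \<Rightarrow> 'a::complex_hilbert) \<Rightarrow> bool" where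
  "orthonormal_basis e \<longleftrightarrow> orthonormal_family e \<and> closure (complex_span e) = UNIV"

text \<open>\<open>weak_R_dual u v f w\<close>: the family \<open>w\<close> is the weak R-dual of \<open>f\<close> with respect to \<open>u\<close> and \<open>v\<close>.\<close>

definition weak_R_dual ::
  "('i \<Rightarrow> 'a::complex_hilbert) \<Rightarrow> ('i \<Rightarrow> 'a) \<Rightarrow> ('i \<Rightarrow> 'a) \<Rightarrow> ('i \<Rightarrow> 'a) \<Rightarrow> bool" where
  "weak_R_dual u v f w \<longleftrightarrow>
     parseval_frame u \<and> parseval_frame v \<and>
     (\<forall>j. (\<lambda>i. (cmod (cinner (f i) (u j)))\<^sup>2) summable_on UNIV) \<and>
     (\<forall>i j. ((\<lambda>k. cinner (v k) (v i) * cinner (f k) (u j)) has_sum cinner (f i) (u j)) UNIV) \<and>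
     (\<forall>j. ((\<lambda>i. cinner (f i) (u j) *\<^sub>C v i) has_sum w j) UNIV)"


section \<open>The Hilbert space of square-integrable functions on the real line\<close>

text \<open>Elements are classes of Borel functions modulo equality almost everywhere. Since every Lebesgue
  measurable function agrees almost everywhere with a Borel function, using \<open>lborel\<close> instead of
  \<open>lebesgue\<close> yields the same space.\<close>

definition square_integrable :: "(real \<Rightarrow> complex) \<Rightarrow> bool" where
  "square_integrable f \<longleftrightarrow>
     f \<in> borel_measurable lborel \<and> integrable lborel (\<lambda>t. (cmod (f t))\<^sup>2)"

definition L2_eq :: "(real \<Rightarrow> complex) \<Rightarrow> (real \<Rightarrow> complex) \<Rightarrow> bool" where
  "L2_eq f g \<longleftrightarrow> square_integrable f \<and> square_integrable g \<and> (AE t in lborel. f t = g t)"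

lemma square_integrable_meas: "square_integrable f \<Longrightarrow> f \<in> borel_measurable borel"
  by (simp add: square_integrable_def)

lemma borel_measurable_cnj [measurable (raw)]:
  "f \<in> borel_measurable M \<Longrightarrow> (\<lambda>x. cnj (f x)) \<in> borel_measurable M"
  by (rule measurable_compose[OF _ borel_measurable_continuous_onI])
    (auto intro: continuous_intros)

lemma AE_eq_map:
  assumes "AE t in M. f t = f' t"
  shows "AE t in M. h t (f t) = h t (f' t)"
  using assms by eventually_elim simp

lemma AE_eq_map2:
  assumes "AE t in M. f t = f' t" and "AE t in M. g t = g' t"
  shows "AE t in M. h (f t) (g t) = h (f' t) (g' t)"
  using assms by eventually_elim simp

lemma square_integrable_zero: "square_integrable (\<lambda>_. 0)"
  by (simp add: square_integrable_def)

lemma square_integrable_cmult: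
  assumes "square_integrable f"
  shows "square_integrable (\<lambda>t. c * f t)"
  using assms by (auto simp: square_integrable_def norm_mult power_mult_distrib)

lemma square_integrable_add:
  assumes f: "square_integrable f" and g: "square_integrable g"
  shows "square_integrable (\<lambda>t. f t + g t)"
proof -
  note [measurable] = square_integrable_meas[OF f] square_integrable_meas[OF g]
  have "integrable lborel (\<lambda>t. 2 * (cmod (f t))\<^sup>2 + 2 * (cmod (g t))\<^sup>2)"
    using f g by (simp add: square_integrable_def)
  then have "integrable lborel (\<lambda>t. (cmod (f t + g t))\<^sup>2)"
  proof (rule Bochner_Integration.integrable_bound)
    have "(cmod (x + y))\<^sup>2 \<le> 2 * (cmod x)\<^sup>2 + 2 * (cmod y)\<^sup>2" for x y
    proof -
      have "(cmod (x + y))\<^sup>2 \<le> (cmod x + cmod y)\<^sup>2"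
        by (simp add: norm_triangle_ineq power_mono)
      also have "\<dots> \<le> 2 * (cmod x)\<^sup>2 + 2 * (cmod y)\<^sup>2"
        using sum_squares_bound[of "cmod x" "cmod y"] by (simp add: power2_sum)
      finally show ?thesis .
    qed
    then show "AE t in lborel. norm ((cmod (f t + g t))\<^sup>2)
        \<le> norm (2 * (cmod (f t))\<^sup>2 + 2 * (cmod (g t))\<^sup>2)"
      by simp
  qed measurable
  then show ?thesis by (simp add: square_integrable_def)
qed

lemma square_integrable_mult_cnj:
  assumes f: "square_integrable f" and g: "square_integrable g"
  shows "integrable lborel (\<lambda>t. f t * cnj (g t))"
proof -
  note [measurable] = square_integrable_meas[OF f] square_integrable_meas[OF g]
  have "integrable lborel (\<lambda>t. (cmod (f t))\<^sup>2 + (cmod (g t))\<^sup>2)"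
    using f g by (simp add: square_integrable_def)
  then show ?thesis
  proof (rule Bochner_Integration.integrable_bound)
    have "cmod x * cmod y \<le> (cmod x)\<^sup>2 + (cmod y)\<^sup>2" for x y
      using sum_squares_bound[of "cmod x" "cmod y"] mult_nonneg_nonneg[of "cmod x" "cmod y"]
      by (simp del: mult_nonneg_nonneg)
    then show "AE t in lborel. norm (f t * cnj (g t)) \<le> norm ((cmod (f t))\<^sup>2 + (cmod (g t))\<^sup>2)"
      by (simp add: norm_mult)
  qed measurable
qed

lemma square_integrable_modulate:
  assumes "square_integrable f"
  shows "square_integrable (\<lambda>t. exp (2 * of_real pi * \<i> * of_real x * of_real t) * f t)"
proof -
  note [measurable] = square_integrable_meas[OF assms]
  have "cmod (exp (2 * of_real pi * \<i> * of_real x * of_real t)) = 1" for t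
    by (simp add: norm_exp_eq_Re)
  then show ?thesis
    using assms by (simp add: square_integrable_def norm_mult)
qed

lemma square_integrable_translate:
  assumes "square_integrable f"
  shows "square_integrable (\<lambda>t. f (t - x))"
proof -
  note [measurable] = square_integrable_meas[OF assms]
  have "integrable lborel (\<lambda>t. (cmod (f (- x + 1 * t)))\<^sup>2)"
    using assms by (intro lborel_integrable_real_affine) (simp_all add: square_integrable_def)
  then show ?thesis by (simp add: square_integrable_def)
qed

lemma AE_translate:
  fixes f g :: "real \<Rightarrow> complex"
  assumes [measurable]: "f \<in> borel_measurable borel" "g \<in> borel_measurable borel"
    and "AE t in lborel. f t = g t"
  shows "AE t in lborel. f (t - x) = g (t - x)"
  using AE_borel_affine[of 1 "\<lambda>t. f t = g t" "- x"] assms by simp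

quotient_type L2 = "real \<Rightarrow> complex" / partial: L2_eq
proof (rule part_equivpI)
  show "\<exists>f. L2_eq f f"
    using square_integrable_zero by (auto simp: L2_eq_def)
  show "symp L2_eq"
    by (rule sympI) (simp add: L2_eq_def eq_commute)
  show "transp L2_eq"
    unfolding transp_def L2_eq_def
  proof (intro allI impI, elim conjE, intro conjI)
    fix f g h :: "real \<Rightarrow> complex"
    assume "AE t in lborel. f t = g t" and "AE t in lborel. g t = h t"
    then show "AE t in lborel. f t = h t"
      by eventually_elim simp
  qed
qed

instantiation L2 :: real_vector
begin

lift_definition zero_L2 :: L2 is "\<lambda>_. 0"
  by (simp add: L2_eq_def square_integrable_zero)

lift_definition plus_L2 :: "L2 \<Rightarrow> L2 \<Rightarrow> L2" is "\<lambda>f g t. f t + g t"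
  unfolding L2_eq_def
  by (elim conjE, intro conjI square_integrable_add; (assumption | rule AE_eq_map2; assumption))

lift_definition uminus_L2 :: "L2 \<Rightarrow> L2" is "\<lambda>f t. - f t"
  unfolding L2_eq_def using square_integrable_cmult[of _ "-1"] by auto

lift_definition scaleR_L2 :: "real \<Rightarrow> L2 \<Rightarrow> L2" is "\<lambda>r f t. complex_of_real r * f t"
  unfolding L2_eq_def
  by (elim conjE, intro conjI square_integrable_cmult; (assumption | rule AE_eq_map; assumption))

definition minus_L2 :: "L2 \<Rightarrow> L2 \<Rightarrow> L2" where
  "minus_L2 x y = x + (- y)"

instance
proof
  fix x y z :: L2 and r s :: real
  show "x + y + z = x + (y + z)"
    by transfer (auto simp: L2_eq_def ac_simps intro!: square_integrable_add)
  show "x + y = y + x"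
    by transfer (auto simp: L2_eq_def ac_simps intro!: square_integrable_add)
  show "0 + x = x"
    by transfer (auto simp: L2_eq_def)
  show "- x + x = 0"
    by transfer (auto simp: L2_eq_def square_integrable_zero)
  show "x - y = x + - y"
    by (simp add: minus_L2_def)
  show "r *\<^sub>R (x + y) = r *\<^sub>R x + r *\<^sub>R y"
    by transfer
      (auto simp: L2_eq_def distrib_left intro!: square_integrable_add square_integrable_cmult)
  show "(r + s) *\<^sub>R x = r *\<^sub>R x + s *\<^sub>R x"
    by transfer
      (auto simp: L2_eq_def distrib_right intro!: square_integrable_add square_integrable_cmult)
  show "r *\<^sub>R s *\<^sub>R x = (r * s) *\<^sub>R x"
    by transfer (auto simp: L2_eq_def mult.assoc intro!: square_integrable_cmult)
  show "1 *\<^sub>R x = x"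
    by transfer (auto simp: L2_eq_def)
qed

end

instantiation L2 :: complex_inner
begin

lift_definition scaleC_L2 :: "complex \<Rightarrow> L2 \<Rightarrow> L2" is "\<lambda>c f t. c * f t"
  unfolding L2_eq_def
  by (elim conjE, intro conjI square_integrable_cmult; (assumption | rule AE_eq_map; assumption))

lift_definition cinner_L2 :: "L2 \<Rightarrow> L2 \<Rightarrow> complex" is "\<lambda>f g. \<integral>t. f t * cnj (g t) \<partial>lborel"
  unfolding L2_eq_def
  by (elim conjE, intro integral_cong_AE)
    (auto intro!: borel_measurable_times borel_measurable_cnj dest: square_integrable_meas
      intro: AE_eq_map2[where h = "\<lambda>x y. x * cnj y"])

definition inner_L2 :: "L2 \<Rightarrow> L2 \<Rightarrow> real" where
  "inner_L2 x y = Re (cinner x y)"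

definition norm_L2 :: "L2 \<Rightarrow> real" where
  "norm_L2 x = sqrt (inner x x)"

definition sgn_L2 :: "L2 \<Rightarrow> L2" where
  "sgn_L2 x = x /\<^sub>R norm x"

definition dist_L2 :: "L2 \<Rightarrow> L2 \<Rightarrow> real" where
  "dist_L2 x y = norm (x - y)"

definition uniformity_L2 :: "(L2 \<times> L2) filter" where
  "uniformity_L2 = (INF e\<in>{0<..}. principal {(x, y). dist x y < e})"

definition open_L2 :: "L2 set \<Rightarrow> bool" where
  "open_L2 U \<longleftrightarrow> (\<forall>x\<in>U. eventually (\<lambda>(x', y). x' = x \<longrightarrow> y \<in> U) uniformity)"

instance
proof
  fix x y z :: L2 and c d :: complex and r :: real
  show add: "cinner (x + y) z = cinner x z + cinner y z" for x y z :: L2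
    by transfer
      (auto simp: L2_eq_def distrib_right square_integrable_mult_cnj
        intro!: Bochner_Integration.integral_add)
  show scale: "cinner (c *\<^sub>C x) y = c * cinner x y" for c and x y :: L2
    by transfer (simp add: mult.assoc)
  show comm: "cinner x y = cnj (cinner y x)" for x y :: L2
    by transfer
      (subst Bochner_Integration.integral_cnj[symmetric], simp add: mult.commute)
  show scaleRC: "r *\<^sub>R x = complex_of_real r *\<^sub>C x" for r and x :: L2
    by transfer (auto simp: L2_eq_def intro!: square_integrable_cmult)
  show "inner x y = Re (cinner x y)"
    by (simp add: inner_L2_def)
  show "c *\<^sub>C (x + y) = c *\<^sub>C x + c *\<^sub>C y"
    by transfer
      (auto simp: L2_eq_def distrib_left intro!: square_integrable_add square_integrable_cmult)
  show "(c + d) *\<^sub>C x = c *\<^sub>C x + d *\<^sub>C x"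
    by transfer
      (auto simp: L2_eq_def distrib_right intro!: square_integrable_add square_integrable_cmult)
  show "c *\<^sub>C d *\<^sub>C x = (c * d) *\<^sub>C x"
    by transfer (auto simp: L2_eq_def mult.assoc intro!: square_integrable_cmult)
  show "inner x y = inner y x"
    using comm[of x y] by (simp add: inner_L2_def)
  show "inner (x + y) z = inner x z + inner y z"
    by (simp add: inner_L2_def add)
  show "inner (r *\<^sub>R x) y = r * inner x y"
    by (simp add: inner_L2_def scaleRC scale)
  have *: "Re (\<integral>t. f t * cnj (f t) \<partial>lborel) = (\<integral>t. (cmod (f t))\<^sup>2 \<partial>lborel)" for f
    by (simp add: complex_norm_square[symmetric] del: of_real_power)
  show "0 \<le> inner x x"
    unfolding inner_L2_def by transfer (simp add: *)
  show "inner x x = 0 \<longleftrightarrow> x = 0"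
    unfolding inner_L2_def
  proof transfer
    fix f assume "L2_eq f f"
    then have f: "square_integrable f" by (simp add: L2_eq_def)
    then have "Re (\<integral>t. f t * cnj (f t) \<partial>lborel) = 0 \<longleftrightarrow> (AE t in lborel. (cmod (f t))\<^sup>2 = 0)"
      unfolding * by (intro integral_nonneg_eq_0_iff_AE) (auto simp: square_integrable_def)
    with f show "Re (\<integral>t. f t * cnj (f t) \<partial>lborel) = 0 \<longleftrightarrow> L2_eq f (\<lambda>_. 0)"
      by (simp add: L2_eq_def square_integrable_zero)
  qed
qed (simp_all add: norm_L2_def sgn_L2_def dist_L2_def uniformity_L2_def open_L2_def)

end

lemma norm_L2_eq_integral:
  assumes "square_integrable f"
  shows "(norm (abs_L2 f))\<^sup>2 = (\<integral>t. (cmod (f t))\<^sup>2 \<partial>lborel)"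
proof -
  have "(norm (abs_L2 f))\<^sup>2 = Re (\<integral>t. f t * cnj (f t) \<partial>lborel)"
    using assms by (simp add: power2_norm_eq_inner inner_L2_def cinner_L2.abs_eq L2_eq_def)
  then show ?thesis
    by (simp add: complex_norm_square[symmetric] del: of_real_power)
qed

lemma nn_integral_eq_norm_L2:
  assumes "square_integrable f"
  shows "(\<integral>\<^sup>+t. ennreal ((cmod (f t))\<^sup>2) \<partial>lborel) = ennreal ((norm (abs_L2 f))\<^sup>2)"
  using assms unfolding norm_L2_eq_integral[OF assms]
  by (intro nn_integral_eq_integral) (auto simp: square_integrable_def)

lemma abs_L2_diff:
  assumes "square_integrable f" "square_integrable g"
  shows "abs_L2 f - abs_L2 g = abs_L2 (\<lambda>t. f t - g t)"
  using assms square_integrable_cmult[OF assms(2), of "-1"]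
  by (simp add: minus_L2_def uminus_L2.abs_eq plus_L2.abs_eq L2_eq_def)

lemma square_integrable_diff:
  assumes "square_integrable f" "square_integrable g"
  shows "square_integrable (\<lambda>t. f t - g t)"
  using square_integrable_add[OF assms(1) square_integrable_cmult[OF assms(2), of "-1"]] by simp

lemma L2_representatives:
  obtains g where "\<And>n. square_integrable (g n)" "\<And>n. X n = abs_L2 (g n)"
proof -
  have "\<exists>f. square_integrable f \<and> x = abs_L2 f" for x
    by (induction x rule: L2.abs_induct) (auto simp: L2_eq_def)
  then have "\<forall>n. \<exists>f. square_integrable f \<and> X n = abs_L2 f"
    by blast
  then obtain g where "\<forall>n. square_integrable (g n) \<and> X n = abs_L2 (g n)"
    by (rule choice[THEN exE])
  then show ?thesis using that by blast
qed

text \<open>The Riesz-Fischer theorem.\<close>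

lemma L2_fast_Cauchy_convergent:
  fixes g :: "nat \<Rightarrow> real \<Rightarrow> complex"
  assumes g: "\<And>n. square_integrable (g n)"
    and fast: "\<And>m n. n \<le> m \<Longrightarrow> norm (abs_L2 (g m) - abs_L2 (g n)) \<le> (1/4) ^ n"
  shows "\<exists>G. square_integrable G \<and> (\<lambda>n. abs_L2 (g n)) \<longlonglongrightarrow> abs_L2 G"
proof -
  note [measurable] = square_integrable_meas[OF g]
  define d where "d m n = (\<lambda>t. (cmod (g m t - g n t))\<^sup>2)" for m n
  have [measurable]: "d m n \<in> borel_measurable borel" for m n
    unfolding d_def by measurable
  have d: "(\<integral>\<^sup>+t. ennreal (d m n t) \<partial>lborel) \<le> ennreal ((1/16) ^ n)" if "n \<le> m" for m n
  proof -
    have "(norm (abs_L2 (g m) - abs_L2 (g n)))\<^sup>2 \<le> ((1/4) ^ n)\<^sup>2"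
      using fast[OF that] by (intro power_mono) auto
    also have "\<dots> = (1/16) ^ n"
      by (simp add: power2_eq_square power_mult_distrib[symmetric])
    finally show ?thesis
      unfolding d_def nn_integral_eq_norm_L2[OF square_integrable_diff[OF g g]]
      by (simp add: abs_L2_diff g ennreal_leI)
  qed
  have "(\<integral>\<^sup>+t. (\<Sum>k. ennreal (4 ^ k * d (Suc k) k t)) \<partial>lborel)
      = (\<Sum>k. \<integral>\<^sup>+t. ennreal (4 ^ k * d (Suc k) k t) \<partial>lborel)"
    by (intro nn_integral_suminf) measurable
  also have "\<dots> \<le> (\<Sum>k. ennreal ((1/4) ^ k))"
  proof (intro suminf_le summableI)
    fix k
    have "(\<integral>\<^sup>+t. ennreal (4 ^ k * d (Suc k) k t) \<partial>lborel)
        = ennreal (4 ^ k) * (\<integral>\<^sup>+t. ennreal (d (Suc k) k t) \<partial>lborel)"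
      by (subst nn_integral_cmult[symmetric]) (auto simp: ennreal_mult d_def)
    also have "\<dots> \<le> ennreal (4 ^ k) * ennreal ((1/16) ^ k)"
      by (intro mult_left_mono d) auto
    also have "\<dots> = ennreal ((1/4) ^ k)"
      by (simp add: ennreal_mult[symmetric] power_mult_distrib[symmetric])
    finally show "(\<integral>\<^sup>+t. ennreal (4 ^ k * d (Suc k) k t) \<partial>lborel) \<le> ennreal ((1/4) ^ k)" .
  qed
  also have "\<dots> < \<infinity>"
    by (subst suminf_ennreal2) auto
  finally have "AE t in lborel. (\<Sum>k. ennreal (4 ^ k * d (Suc k) k t)) \<noteq> \<infinity>"
    by (intro nn_integral_PInf_AE) auto
  then have conv: "AE t in lborel. convergent (\<lambda>k. g k t)"
  proof (rule AE_mp, intro AE_I2 impI)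
    fix t assume fin: "(\<Sum>k. ennreal (4 ^ k * d (Suc k) k t)) \<noteq> \<infinity>"
    then have "summable (\<lambda>k. 4 ^ k * d (Suc k) k t)"
      by (intro summable_suminf_not_top) (auto simp: d_def)
    then have "Bseq (\<lambda>k. 4 ^ k * d (Suc k) k t)"
      by (intro convergent_imp_Bseq) (auto dest: summable_LIMSEQ_zero simp: convergent_def)
    then obtain C where C: "C > 0" "\<And>k. norm (4 ^ k * d (Suc k) k t) \<le> C"
      by (auto simp: Bseq_def)
    have "summable (\<lambda>k. g (Suc k) t - g k t)"
    proof (rule summable_comparison_test')
      show "summable (\<lambda>k. sqrt C * (1/2) ^ k)"
        by (intro summable_mult summable_geometric) auto
      fix k
      have "(2 ^ k * norm (g (Suc k) t - g k t))\<^sup>2 \<le> C"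
        using C(2)[of k]
        by (simp add: d_def power_mult_distrib power_mult[symmetric] mult.commute[of _ 2] power_mult)
      then have "2 ^ k * norm (g (Suc k) t - g k t) \<le> sqrt C"
        by (rule real_le_rsqrt)
      then show "norm (g (Suc k) t - g k t) \<le> sqrt C * (1/2) ^ k"
        by (simp add: field_simps power_divide)
    qed
    then have "convergent (\<lambda>n. \<Sum>k<n. g (Suc k) t - g k t)"
      by (simp add: summable_iff_convergent)
    then have "convergent (\<lambda>n. g n t - g 0 t)"
      by (simp only: sum_lessThan_telescope[of "\<lambda>k. g k t"])
    then show "convergent (\<lambda>n. g n t)"
      using convergent_add[OF _ convergent_const[of "g 0 t"], of "\<lambda>n. g n t - g 0 t"] by simp
  qed
  define G where "G t = lim (\<lambda>k. g k t)" for t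
  have [measurable]: "G \<in> borel_measurable borel"
    unfolding G_def by measurable
  have lim: "AE t in lborel. (\<lambda>k. g k t) \<longlonglongrightarrow> G t"
    using conv by (simp add: G_def convergent_LIMSEQ_iff)
  have bound: "(\<integral>\<^sup>+t. ennreal ((cmod (G t - g n t))\<^sup>2) \<partial>lborel) \<le> ennreal ((1/16) ^ n)" for n
  proof -
    have "(\<integral>\<^sup>+t. ennreal ((cmod (G t - g n t))\<^sup>2) \<partial>lborel)
        = (\<integral>\<^sup>+t. liminf (\<lambda>k. ennreal (d k n t)) \<partial>lborel)"
    proof (intro nn_integral_cong_AE, use lim in \<open>rule AE_mp\<close>, intro AE_I2 impI)
      fix t assume "(\<lambda>k. g k t) \<longlonglongrightarrow> G t"
      then have "(\<lambda>k. ennreal (d k n t)) \<longlonglongrightarrow> ennreal ((cmod (G t - g n t))\<^sup>2)"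
        unfolding d_def by (intro tendsto_intros)
      then show "ennreal ((cmod (G t - g n t))\<^sup>2) = liminf (\<lambda>k. ennreal (d k n t))"
        by (simp add: lim_imp_Liminf)
    qed
    also have "\<dots> \<le> liminf (\<lambda>k. \<integral>\<^sup>+t. ennreal (d k n t) \<partial>lborel)"
      by (intro nn_integral_liminf) measurable
    also have "\<dots> \<le> liminf (\<lambda>k. ennreal ((1/16) ^ n))"
      by (intro Liminf_mono eventually_sequentiallyI[of n] d)
    also have "\<dots> = ennreal ((1/16) ^ n)"
      by (simp add: Liminf_const)
    finally show ?thesis .
  qed
  have diff: "square_integrable (\<lambda>t. G t - g n t)" for n
    using bound[of n] unfolding square_integrable_def
    by (auto simp: integrable_iff_bounded le_less_trans[OF _ ennreal_less_top])
  have G: "square_integrable G"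
    using square_integrable_add[OF diff[of 0] g[of 0]] by simp
  have "norm (abs_L2 (g n) - abs_L2 G) \<le> (1/4) ^ n" for n
  proof -
    have "ennreal ((norm (abs_L2 G - abs_L2 (g n)))\<^sup>2) \<le> ennreal ((1/16) ^ n)"
      using bound[of n] by (simp add: abs_L2_diff G g nn_integral_eq_norm_L2 diff)
    then have "(norm (abs_L2 G - abs_L2 (g n)))\<^sup>2 \<le> ((1/4) ^ n)\<^sup>2"
      by (simp add: power2_eq_square power_mult_distrib[symmetric])
    then show ?thesis
      by (auto simp: norm_minus_commute intro: power2_le_imp_le)
  qed
  then have "(\<lambda>n. abs_L2 (g n) - abs_L2 G) \<longlonglongrightarrow> 0"
    by (intro Lim_null_comparison[OF _ LIMSEQ_realpow_zero[of "1/4"]]) auto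
  then have "(\<lambda>n. abs_L2 (g n)) \<longlonglongrightarrow> abs_L2 G"
    by (simp add: LIM_zero_iff)
  with G show ?thesis by blast
qed

instance L2 :: complex_hilbert
proof
  fix X :: "nat \<Rightarrow> L2"
  assume X: "Cauchy X"
  have "\<exists>N. \<forall>m\<ge>N. \<forall>n\<ge>N. norm (X m - X n) < (1/4) ^ k" for k :: nat
    using CauchyD[OF X, of "(1/4) ^ k"] by simp
  then obtain N where N: "\<And>k m n. N k \<le> m \<Longrightarrow> N k \<le> n \<Longrightarrow> norm (X m - X n) < (1/4) ^ k"
    by metis
  define r where "r k = (\<Sum>i\<le>k. Suc (N i))" for k
  have r: "strict_mono r"
    by (simp add: strict_mono_Suc_iff r_def)
  have Nr: "N k \<le> r k" for k
    using member_le_sum[of k "{..k}" "\<lambda>i. Suc (N i)"] by (simp add: r_def)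
  obtain g where g: "\<And>n. square_integrable (g n)" "\<And>n. (X \<circ> r) n = abs_L2 (g n)"
    using L2_representatives[of "X \<circ> r"] by blast
  have "norm (abs_L2 (g m) - abs_L2 (g n)) \<le> (1/4) ^ n" if "n \<le> m" for m n
    using N[of n "r m" "r n"] Nr[of n] strict_mono_leD[OF r that]
    by (simp add: g(2)[symmetric] less_imp_le)
  from L2_fast_Cauchy_convergent[OF g(1) this]
  obtain G where "(X \<circ> r) \<longlonglongrightarrow> abs_L2 G"
    unfolding g(2)[symmetric] by blast
  then have "X \<longlonglongrightarrow> abs_L2 G"
    by (rule Cauchy_converges_subseq[OF X r])
  then show "convergent X"
    by (auto simp: convergent_def)
qed


section \<open>Time-frequency shifts\<close>

lift_definition modulation :: "real \<Rightarrow> L2 \<Rightarrow> L2"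
  is "\<lambda>x g t. exp (2 * of_real pi * \<i> * of_real x * of_real t) * g t"
  unfolding L2_eq_def
  by (elim conjE, intro conjI square_integrable_modulate; (assumption | rule AE_eq_map; assumption))

lift_definition translation :: "real \<Rightarrow> L2 \<Rightarrow> L2"
  is "\<lambda>x g t. g (t - x)"
  unfolding L2_eq_def
  by (elim conjE, intro conjI AE_translate square_integrable_meas)
    (rule square_integrable_translate; assumption | assumption)+

definition gabor_system :: "real \<Rightarrow> real \<Rightarrow> L2 \<Rightarrow> int \<times> int \<Rightarrow> L2" where
  "gabor_system a b f = (\<lambda>(m, n). modulation (of_int m * b) (translation (of_int n * a) f))"

definition adjoint_gabor_system :: "real \<Rightarrow> real \<Rightarrow> L2 \<Rightarrow> int \<times> int \<Rightarrow> L2" where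
  "adjoint_gabor_system a b f =
     (\<lambda>(m, n). (1 / sqrt (a * b)) *\<^sub>R
        modulation (of_int m / a) (translation (of_int n / b) f))"

end

theory Submission
  imports Defs
begin

text \<open>Let \<open>A\<close> be the frame bound of the Gabor system \<open>g\<close>. Parseval's identity for Fourier series on an interval
  of length \<open>1/b > a\<close> turns tightness of \<open>g\<close> into the duality relation that the adjoint system \<open>w\<close> is orthogonal
  with squared norms \<open>A\<close>; in particular every element of \<open>g\<close> has squared norm \<open>abA < A\<close>.

  For any orthonormal basis \<open>u\<close>, the vectors \<open>(\<langle>g i, u j\<rangle>)\<^sub>i\<close> of \<open>l\<^sup>2(I)\<close> are, by tightness, also orthogonal with
  squared norms \<open>A\<close>, and because \<open>ab < 1\<close> their closed span has infinite codimension. Hence there is a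
  non-surjective isometry \<open>V\<close> from \<open>L\<^sup>2(\<real>)\<close> to \<open>l\<^sup>2(I)\<close> sending \<open>w j\<close> to \<open>(\<langle>g i, u j\<rangle>)\<^sub>i\<close>. The adjoint of \<open>V\<close> maps
  the unit vectors of \<open>l\<^sup>2(I)\<close> to the Parseval frame \<open>v\<close>. Throughout, \<open>l\<^sup>2(I)\<close> is identified with \<open>L\<^sup>2(\<real>)\<close> by means
  of \<open>u\<close>.\<close>

subsection \<open>Complex inner products\<close>

instance complex_hilbert \<subseteq> banach ..

lemma cinner_add_right:
  fixes x y z :: "'a::complex_inner"
  shows "cinner x (y + z) = cinner x y + cinner x z"
  by (metis cinner_add_left cinner_commute complex_cnj_add)

lemma cinner_scaleC_right:
  fixes x y :: "'a::complex_inner"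
  shows "cinner x (c *\<^sub>C y) = cnj c * cinner x y"
  by (metis cinner_scaleC_left cinner_commute complex_cnj_mult)

lemma cinner_scaleR_left:
  fixes x y :: "'a::complex_inner"
  shows "cinner (r *\<^sub>R x) y = of_real r * cinner x y"
  by (simp add: scaleR_scaleC cinner_scaleC_left)

lemma cinner_scaleR_right:
  fixes x y :: "'a::complex_inner"
  shows "cinner x (r *\<^sub>R y) = of_real r * cinner x y"
  by (simp add: scaleR_scaleC cinner_scaleC_right)

lemma cinner_zero_left [simp]:
  fixes x :: "'a::complex_inner"
  shows "cinner 0 x = 0"
  using cinner_scaleR_left[of 0 0 x] by simp

lemma cinner_zero_right [simp]:
  fixes x :: "'a::complex_inner"
  shows "cinner x 0 = 0"
  using cinner_scaleR_right[of x 0 0] by simp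

lemma cinner_diff_left:
  fixes x y z :: "'a::complex_inner"
  shows "cinner (x - y) z = cinner x z - cinner y z"
  using cinner_add_left[of "x - y" y z] by simp

lemma cinner_diff_right:
  fixes x y z :: "'a::complex_inner"
  shows "cinner x (y - z) = cinner x y - cinner x z"
  using cinner_add_right[of x "y - z" z] by simp

lemma cinner_sum_left:
  fixes x :: "'a::complex_inner"
  shows "cinner (\<Sum>i\<in>F. g i) x = (\<Sum>i\<in>F. cinner (g i) x)"
  by (induction F rule: infinite_finite_induct) (auto simp: cinner_add_left)

lemma cinner_sum_right:
  fixes x :: "'a::complex_inner"
  shows "cinner x (\<Sum>i\<in>F. g i) = (\<Sum>i\<in>F. cinner x (g i))"
  by (induction F rule: infinite_finite_induct) (auto simp: cinner_add_right)

lemma cinner_self: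
  fixes x :: "'a::complex_inner"
  shows "cinner x x = of_real ((norm x)\<^sup>2)"
proof (rule complex_eqI)
  show "Re (cinner x x) = Re (complex_of_real ((norm x)\<^sup>2))"
    by (simp add: power2_norm_eq_inner inner_eq_Re_cinner)
  show "Im (cinner x x) = Im (complex_of_real ((norm x)\<^sup>2))"
    using arg_cong[OF cinner_commute[of x x], of Im] by simp
qed

lemma cinner_self_eq_0 [simp]:
  fixes x :: "'a::complex_inner"
  shows "cinner x x = 0 \<longleftrightarrow> x = 0"
  by (simp add: cinner_self)

lemma norm_eq_1_of_cinner:
  fixes x :: "'a::complex_inner"
  assumes "cinner x x = 1"
  shows "norm x = 1"
proof -
  have "complex_of_real ((norm x)\<^sup>2) = of_real 1"
    using assms unfolding cinner_self by simp
  then have "(norm x)\<^sup>2 = 1"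
    unfolding of_real_eq_iff .
  then show ?thesis
    by (simp add: power2_eq_1_iff) (metis norm_ge_zero neg_0_le_iff_le not_one_le_zero)
qed

lemma cinner_eq_0_commute:
  fixes x :: "'a::complex_inner"
  shows "cinner x y = 0 \<longleftrightarrow> cinner y x = 0"
  by (metis cinner_commute complex_cnj_zero)

lemma norm_scaleC:
  fixes x :: "'a::complex_inner"
  shows "norm (c *\<^sub>C x) = cmod c * norm x"
proof -
  have "complex_of_real ((norm (c *\<^sub>C x))\<^sup>2) = (c * cnj c) * of_real ((norm x)\<^sup>2)"
    by (simp add: cinner_self[symmetric] cinner_scaleC_left cinner_scaleC_right del: of_real_power)
  also have "\<dots> = complex_of_real ((cmod c * norm x)\<^sup>2)"
    by (simp add: complex_norm_square[symmetric] power_mult_distrib)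
  finally have "(norm (c *\<^sub>C x))\<^sup>2 = (cmod c * norm x)\<^sup>2"
    by (simp only: of_real_eq_iff)
  then show ?thesis
    by (simp add: power2_eq_iff_nonneg)
qed

text \<open>Multiplying \<open>x\<close> by a unimodular \<open>c\<close> makes the inner product
  real and nonnegative, so Cauchy-Schwarz for the underlying real inner product applies.\<close>

lemma cmod_cinner_le:
  fixes x y :: "'a::complex_inner"
  shows "cmod (cinner x y) \<le> norm x * norm y"
proof (cases "cinner x y = 0")
  case False
  define c where "c = cnj (cinner x y) / of_real (cmod (cinner x y))"
  have "cmod c = 1"
    using False by (simp add: c_def norm_divide)
  have "c * cinner x y = of_real ((cmod (cinner x y))\<^sup>2) / of_real (cmod (cinner x y))"
    by (simp only: c_def complex_norm_square) (simp add: mult.commute)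
  also have "\<dots> = of_real (cmod (cinner x y))"
    using False by (simp add: power2_eq_square)
  finally have "c * cinner x y = of_real (cmod (cinner x y))" .
  then have "cmod (cinner x y) = inner (c *\<^sub>C x) y"
    by (simp add: inner_eq_Re_cinner cinner_scaleC_left)
  also have "\<dots> \<le> norm (c *\<^sub>C x) * norm y"
    by (rule norm_cauchy_schwarz)
  finally show ?thesis
    using \<open>cmod c = 1\<close> by (simp add: norm_scaleC)
qed simp

lemma bounded_linear_cinner_left:
  fixes y :: "'a::complex_inner"
  shows "bounded_linear (\<lambda>x. cinner x y)"
  by (rule bounded_linear_intro[where K = "norm y"])
    (simp_all add: cinner_add_left cinner_scaleR_left cmod_cinner_le scaleR_conv_of_real)

lemma norm_add_orthogonal:
  fixes x y :: "'a::complex_inner"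
  assumes "cinner x y = 0"
  shows "(norm (x + y))\<^sup>2 = (norm x)\<^sup>2 + (norm y)\<^sup>2"
proof -
  have "complex_of_real ((norm (x + y))\<^sup>2) = of_real ((norm x)\<^sup>2 + (norm y)\<^sup>2)"
    using assms cinner_eq_0_commute[of x y]
    by (simp add: cinner_self[symmetric] cinner_add_left cinner_add_right del: of_real_power)
  then show ?thesis
    by (simp only: of_real_eq_iff)
qed

subsection \<open>Synthesis with Bessel families\<close>

text \<open>Small sums off \<open>F0\<close> keep all finite sums over supersets of
  \<open>F0\<close> within \<open>e / 2\<close> of the sum over \<open>F0\<close>; hence the net of
  finite sums is Cauchy, and completeness gives a limit.\<close>

lemma summable_on_tail_criterion:
  fixes f :: "'i \<Rightarrow> 'b::banach"
  assumes "\<And>e. e > 0 \<Longrightarrow> \<exists>F0. finite F0 \<and> (\<forall>F. finite F \<and> F \<inter> F0 = {} \<longrightarrow> norm (sum f F) < e)"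
  shows "f summable_on UNIV"
proof -
  have "\<exists>P. eventually P (finite_subsets_at_top UNIV) \<and>
              (\<forall>F F'. P F \<and> P F' \<longrightarrow> dist (sum f F) (sum f F') < e)" if "e > 0" for e
  proof -
    have "e / 2 > 0" using that by simp
    then obtain F0 where F0: "finite F0" "\<And>F. finite F \<Longrightarrow> F \<inter> F0 = {} \<Longrightarrow> norm (sum f F) < e / 2"
      using assms[of "e / 2"] by blast
    define P where "P F \<longleftrightarrow> finite F \<and> F0 \<subseteq> F" for F
    have "dist (sum f F) (sum f F') < e" if "P F" "P F'" for F F'
    proof -
      have "dist (sum f G) (sum f F0) < e / 2" if "P G" for G
        using F0(2)[of "G - F0"] that by (auto simp: P_def dist_norm sum_diff)
      from this[OF that(1)] this[OF that(2)] show ?thesis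
        by (metis dist_triangle_half_l dist_commute)
    qed
    moreover have "eventually P (finite_subsets_at_top UNIV)"
      using F0(1) by (auto simp: P_def eventually_finite_subsets_at_top)
    ultimately show ?thesis by blast
  qed
  then have "cauchy_filter (filtermap (sum f) (finite_subsets_at_top UNIV))"
    by (simp add: cauchy_filter_metric_filtermap)
  moreover have "complete (UNIV :: 'b set)"
    by (meson Cauchy_convergent UNIV_I complete_def convergent_def)
  ultimately obtain L where "(sum f \<longlongrightarrow> L) (finite_subsets_at_top UNIV)"
    using complete_uniform[where S = UNIV] by (force simp add: filterlim_def)
  then show ?thesis
    using summable_on_def has_sum_def by blast
qed

text \<open>Bound 1 covers both Parseval frames and orthonormal families. Stating it through finite
  partial sums keeps summability out of the definition.\<close>

definition bessel :: "('i \<Rightarrow> 'a::complex_hilbert) \<Rightarrow> bool" where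
  "bessel e \<longleftrightarrow> (\<forall>x F. finite F \<longrightarrow> (\<Sum>i\<in>F. (cmod (cinner x (e i)))\<^sup>2) \<le> (norm x)\<^sup>2)"

lemma bessel_summable:
  assumes "bessel e"
  shows "(\<lambda>i. (cmod (cinner x (e i)))\<^sup>2) summable_on UNIV"
  using assms by (intro nonneg_bdd_above_summable_on bdd_aboveI2[where M = "(norm x)\<^sup>2"])
    (auto simp: bessel_def)

lemma parseval_frame_imp_bessel:
  assumes "parseval_frame e"
  shows "bessel e"
  using assms unfolding parseval_frame_def tight_frame_bound_def bessel_def
  by (auto intro!: finite_sum_le_has_sum)

text \<open>Pairing the sum \<open>y\<close> with itself and applying Cauchy-Schwarz to the
  resulting sum of products bounds \<open>(norm y)\<^sup>2\<close> by \<open>C * norm y\<close>; one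
  factor then cancels.\<close>

lemma norm_sum_bessel_le:
  fixes e :: "'i \<Rightarrow> 'a::complex_hilbert"
  assumes "bessel e" "finite F"
  shows "(norm (\<Sum>i\<in>F. c i *\<^sub>C e i))\<^sup>2 \<le> (\<Sum>i\<in>F. (cmod (c i))\<^sup>2)"
proof -
  define y where "y = (\<Sum>i\<in>F. c i *\<^sub>C e i)"
  define C where "C = L2_set (\<lambda>i. cmod (c i)) F"
  have "complex_of_real ((norm y)\<^sup>2) = (\<Sum>i\<in>F. c i * cinner (e i) y)"
    unfolding cinner_self[symmetric]
    by (subst y_def) (simp add: cinner_sum_left cinner_scaleC_left)
  then have "(norm y)\<^sup>2 = cmod (\<Sum>i\<in>F. c i * cinner (e i) y)"
    by (metis norm_of_real abs_of_nonneg zero_le_power2)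
  also have "\<dots> \<le> (\<Sum>i\<in>F. \<bar>cmod (c i)\<bar> * \<bar>cmod (cinner y (e i))\<bar>)"
    by (rule order_trans[OF norm_sum])
      (simp add: norm_mult cinner_commute[of "e _" y])
  also have "\<dots> \<le> C * L2_set (\<lambda>i. cmod (cinner y (e i))) F"
    unfolding C_def by (rule L2_set_mult_ineq)
  also have "\<dots> \<le> C * norm y"
    using assms by (intro mult_left_mono)
      (auto simp: C_def L2_set_def bessel_def intro!: real_le_lsqrt sum_nonneg)
  finally have "norm y \<le> C"
    by (cases "norm y = 0") (auto simp: power2_eq_square C_def)
  then have "(norm y)\<^sup>2 \<le> C\<^sup>2"
    by (intro power_mono) auto
  then show ?thesis
    by (simp add: y_def C_def L2_set_def sum_nonneg)
qed

text \<open>The coefficients have small square-summable tails, and \<open>norm_sum_bessel_le\<close>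
  carries this smallness over to the vector sums.\<close>

lemma bessel_synthesis_summable:
  fixes e :: "'i \<Rightarrow> 'a::complex_hilbert"
  assumes e: "bessel e" and c: "(\<lambda>i. (cmod (c i))\<^sup>2) summable_on UNIV"
  shows "(\<lambda>i. c i *\<^sub>C e i) summable_on UNIV"
proof (rule summable_on_tail_criterion)
  fix r :: real assume "r > 0"
  define L where "L = infsum (\<lambda>i. (cmod (c i))\<^sup>2) UNIV"
  have L: "((\<lambda>i. (cmod (c i))\<^sup>2) has_sum L) UNIV"
    using c by (simp add: L_def)
  then obtain F0 where F0: "finite F0" "dist (\<Sum>i\<in>F0. (cmod (c i))\<^sup>2) L \<le> r\<^sup>2 / 2"
    using has_sum_finite_approximation[OF L, of "r\<^sup>2 / 2"] \<open>r > 0\<close> by auto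
  have "norm (\<Sum>i\<in>F. c i *\<^sub>C e i) < r" if "finite F" "F \<inter> F0 = {}" for F
  proof -
    have "(\<Sum>i\<in>F. (cmod (c i))\<^sup>2) + (\<Sum>i\<in>F0. (cmod (c i))\<^sup>2) \<le> L"
      using that F0(1) finite_sum_le_has_sum[OF L, of "F \<union> F0"]
      by (simp add: sum.union_disjoint)
    then have "(\<Sum>i\<in>F. (cmod (c i))\<^sup>2) \<le> r\<^sup>2 / 2"
      using F0(2) unfolding dist_real_def by linarith
    then have "(norm (\<Sum>i\<in>F. c i *\<^sub>C e i))\<^sup>2 \<le> r\<^sup>2 / 2"
      using norm_sum_bessel_le[OF e that(1), of c] by linarith
    also have "\<dots> < r\<^sup>2" using \<open>r > 0\<close> by simp
    finally show ?thesis
      using \<open>r > 0\<close> by (intro power2_less_imp_less[of _ r]) auto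
  qed
  with F0(1) show "\<exists>F0. finite F0 \<and>
      (\<forall>F. finite F \<and> F \<inter> F0 = {} \<longrightarrow> norm (\<Sum>i\<in>F. c i *\<^sub>C e i) < r)"
    by blast
qed

lemma cinner_has_sum_left:
  fixes y :: "'a::complex_hilbert"
  assumes "((\<lambda>i. c i *\<^sub>C e i) has_sum x) UNIV"
  shows "((\<lambda>i. c i * cinner (e i) y) has_sum cinner x y) UNIV"
  using has_sum_bounded_linear[OF bounded_linear_cinner_left assms]
  by (simp add: cinner_scaleC_left)

text \<open>Bessel's inequality, from Pythagoras for the projection \<open>p\<close> of
  \<open>x\<close>. Asking for orthonormality on \<open>F\<close> only makes it applicable to
  indexed families and, with \<open>e\<close> the identity, to orthonormal sets.\<close>

lemma orthonormal_on_bessel: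
  fixes e :: "'i \<Rightarrow> 'a::complex_hilbert"
  assumes "finite F" and "\<And>i j. i \<in> F \<Longrightarrow> j \<in> F \<Longrightarrow> cinner (e i) (e j) = (if i = j then 1 else 0)"
  shows "(\<Sum>i\<in>F. (cmod (cinner x (e i)))\<^sup>2) \<le> (norm x)\<^sup>2"
proof -
  define p where "p = (\<Sum>i\<in>F. cinner x (e i) *\<^sub>C e i)"
  have pe: "cinner p (e j) = cinner x (e j)" if "j \<in> F" for j
  proof -
    have "cinner p (e j) = (\<Sum>i\<in>F. if i = j then cinner x (e i) else 0)"
      unfolding p_def cinner_sum_left using that assms
      by (intro sum.cong) (auto simp: cinner_scaleC_left)
    then show ?thesis using that assms(1) by simp
  qed
  have xp: "cinner y p = (\<Sum>i\<in>F. cnj (cinner x (e i)) * cinner y (e i))" for y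
    by (simp add: p_def cinner_sum_right cinner_scaleC_right)
  have "cinner (x - p) p = 0"
    unfolding cinner_diff_left xp by (simp add: pe)
  then have *: "(norm x)\<^sup>2 = (norm (x - p))\<^sup>2 + (norm p)\<^sup>2"
    using norm_add_orthogonal[of "x - p" p] by simp
  have "complex_of_real ((norm p)\<^sup>2) = of_real (\<Sum>i\<in>F. (cmod (cinner x (e i)))\<^sup>2)"
    unfolding cinner_self[symmetric] xp
    by (simp add: pe complex_norm_square mult.commute del: of_real_power)
  then have "(norm p)\<^sup>2 = (\<Sum>i\<in>F. (cmod (cinner x (e i)))\<^sup>2)"
    by (simp only: of_real_eq_iff)
  then show ?thesis using * by simp
qed

lemma orthonormal_family_imp_bessel: "orthonormal_family e \<Longrightarrow> bessel e"
  unfolding bessel_def orthonormal_family_def by (auto intro!: orthonormal_on_bessel)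

text \<open>The frame identity is combined at four vectors by polarization, which holds alike for
  products of coefficients (\<open>pol\<close>) and for the inner product
  (\<open>pol'\<close>).\<close>

lemma tight_frame_polarization:
  fixes g :: "'i \<Rightarrow> 'a::complex_hilbert"
  assumes "tight_frame_bound A g"
  shows "((\<lambda>i. cinner x (g i) * cinner (g i) y) has_sum of_real A * cinner x y) UNIV"
proof -
  have *: "((\<lambda>i. complex_of_real ((cmod (cinner z (g i)))\<^sup>2)) has_sum of_real A * cinner z z) UNIV" for z
    unfolding cinner_self of_real_mult[symmetric] has_sum_of_real_iff
    using assms by (simp add: tight_frame_bound_def)
  have pol: "s * cnj t = (of_real ((cmod (s + t))\<^sup>2) - of_real ((cmod (s - t))\<^sup>2)
      + \<i> * (of_real ((cmod (s + \<i> * t))\<^sup>2) - of_real ((cmod (s - \<i> * t))\<^sup>2))) / 4" for s t :: complex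
    unfolding complex_norm_square by (simp add: algebra_simps)
  have pol': "cinner x y = (cinner (x + y) (x + y) - cinner (x - y) (x - y)
      + \<i> * (cinner (x + \<i> *\<^sub>C y) (x + \<i> *\<^sub>C y) - cinner (x - \<i> *\<^sub>C y) (x - \<i> *\<^sub>C y))) / 4"
    by (simp add: cinner_add_left cinner_add_right cinner_diff_left cinner_diff_right
        cinner_scaleC_left cinner_scaleC_right algebra_simps)
  have "((\<lambda>i. (of_real ((cmod (cinner (x + y) (g i)))\<^sup>2) - of_real ((cmod (cinner (x - y) (g i)))\<^sup>2)
      + \<i> * (of_real ((cmod (cinner (x + \<i> *\<^sub>C y) (g i)))\<^sup>2)
          - of_real ((cmod (cinner (x - \<i> *\<^sub>C y) (g i)))\<^sup>2))) / 4) has_sum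
     (of_real A * cinner (x + y) (x + y) - of_real A * cinner (x - y) (x - y)
      + \<i> * (of_real A * cinner (x + \<i> *\<^sub>C y) (x + \<i> *\<^sub>C y)
        - of_real A * cinner (x - \<i> *\<^sub>C y) (x - \<i> *\<^sub>C y))) / 4) UNIV"
    unfolding diff_conv_add_uminus
    by (intro has_sum_divide_const has_sum_add has_sum_cmult_right has_sum_uminusI *)
  moreover have "(of_real A * cinner (x + y) (x + y) - of_real A * cinner (x - y) (x - y)
      + \<i> * (of_real A * cinner (x + \<i> *\<^sub>C y) (x + \<i> *\<^sub>C y)
        - of_real A * cinner (x - \<i> *\<^sub>C y) (x - \<i> *\<^sub>C y))) / 4 = of_real A * cinner x y"
    by (subst pol') (simp add: algebra_simps)
  moreover have "(of_real ((cmod (cinner (x + y) (g i)))\<^sup>2) - of_real ((cmod (cinner (x - y) (g i)))\<^sup>2)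
      + \<i> * (of_real ((cmod (cinner (x + \<i> *\<^sub>C y) (g i)))\<^sup>2)
          - of_real ((cmod (cinner (x - \<i> *\<^sub>C y) (g i)))\<^sup>2))) / 4
      = cinner x (g i) * cinner (g i) y" for i
    unfolding cinner_add_left cinner_diff_left cinner_scaleC_left
    by (subst pol[symmetric]) (simp add: cinner_commute[of "g i" y])
  ultimately show ?thesis by simp
qed

text \<open>The series converges by the Bessel property, and by polarization its sum has the same
  inner product with every \<open>y\<close> as \<open>x\<close> has.\<close>

lemma parseval_frame_expansion:
  fixes e :: "'i \<Rightarrow> 'a::complex_hilbert"
  assumes "parseval_frame e"
  shows "((\<lambda>i. cinner x (e i) *\<^sub>C e i) has_sum x) UNIV"
proof -
  have "bessel e"
    using assms by (rule parseval_frame_imp_bessel)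
  then have "(\<lambda>i. cinner x (e i) *\<^sub>C e i) summable_on UNIV"
    by (intro bessel_synthesis_summable bessel_summable)
  then obtain x' where x': "((\<lambda>i. cinner x (e i) *\<^sub>C e i) has_sum x') UNIV"
    by (auto simp: summable_on_def)
  have "cinner x' y = cinner x y" for y
    using has_sum_unique[OF cinner_has_sum_left[OF x']] assms tight_frame_polarization[of 1 e x y]
    by (simp add: parseval_frame_def)
  then have "cinner (x' - x) (x' - x) = 0"
    by (simp add: cinner_diff_left)
  then have "x' = x" by simp
  with x' show ?thesis by simp
qed

subsection \<open>Partial isometries between orthonormal families\<close>

text \<open>For orthonormal \<open>p\<close> and \<open>q\<close> this is the partial isometry
  sending \<open>p i\<close> to \<open>q i\<close> and killing the complement of \<open>p\<close>;
  for \<open>p = q\<close> it is the orthogonal projection onto the closed span.\<close>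

definition transfer_op :: "('i \<Rightarrow> 'a::complex_hilbert) \<Rightarrow> ('i \<Rightarrow> 'a) \<Rightarrow> 'a \<Rightarrow> 'a" where
  "transfer_op p q x = (\<Sum>\<^sub>\<infinity>i. cinner x (p i) *\<^sub>C q i)"

lemma transfer_op_has_sum:
  assumes "bessel p" "bessel q"
  shows "((\<lambda>i. cinner x (p i) *\<^sub>C q i) has_sum transfer_op p q x) UNIV"
  unfolding transfer_op_def
  using assms by (intro has_sum_infsum bessel_synthesis_summable bessel_summable)

lemma cinner_transfer_op_has_sum:
  assumes "bessel p" "bessel q"
  shows "((\<lambda>i. cinner x (p i) * cinner (q i) y) has_sum cinner (transfer_op p q x) y) UNIV"
  by (rule cinner_has_sum_left[OF transfer_op_has_sum[OF assms]])

text \<open>Identifies the adjoint: conjugating the series termwise exchanges the roles of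
  \<open>p\<close> and \<open>q\<close>.\<close>

lemma cinner_transfer_op_commute:
  assumes p: "bessel p" and q: "bessel q"
  shows "cinner (transfer_op p q x) y = cinner x (transfer_op q p y)"
proof -
  have "((\<lambda>i. cnj (cinner y (q i) * cinner (p i) x)) has_sum cnj (cinner (transfer_op q p y) x)) UNIV"
    using cinner_transfer_op_has_sum[OF q p] by (simp only: has_sum_cnj_iff)
  also have "(\<lambda>i. cnj (cinner y (q i) * cinner (p i) x)) = (\<lambda>i. cinner x (p i) * cinner (q i) y)"
    by (simp add: cinner_commute[symmetric] mult.commute)
  also have "cnj (cinner (transfer_op q p y) x) = cinner x (transfer_op q p y)"
    by (rule cinner_commute[symmetric])
  finally show ?thesis
    by (rule has_sum_unique[OF cinner_transfer_op_has_sum[OF p q]])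
qed

lemma cinner_transfer_op_base:
  assumes p: "bessel p" and q: "orthonormal_family q"
  shows "cinner (transfer_op p q x) (q j) = cinner x (p j)"
proof (rule has_sum_unique)
  show "((\<lambda>i. cinner x (p i) * cinner (q i) (q j)) has_sum cinner (transfer_op p q x) (q j)) UNIV"
    by (rule cinner_transfer_op_has_sum[OF p orthonormal_family_imp_bessel[OF q]])
  show "((\<lambda>i. cinner x (p i) * cinner (q i) (q j)) has_sum cinner x (p j)) UNIV"
    by (rule has_sum_finite_neutralI[of "{j}"]) (use q in \<open>auto simp: orthonormal_family_def\<close>)
qed

lemma transfer_op_base:
  assumes p: "orthonormal_family p" and q: "bessel q"
  shows "transfer_op p q (p j) = q j"
proof (rule has_sum_unique)
  show "((\<lambda>i. cinner (p j) (p i) *\<^sub>C q i) has_sum transfer_op p q (p j)) UNIV"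
    by (rule transfer_op_has_sum[OF orthonormal_family_imp_bessel[OF p] q])
  have "0 *\<^sub>C y = 0" "1 *\<^sub>C y = y" for y :: "'b::complex_hilbert"
    using scaleR_scaleC[of 0 y] scaleR_scaleC[of 1 y] by simp_all
  then show "((\<lambda>i. cinner (p j) (p i) *\<^sub>C q i) has_sum q j) UNIV"
    using p by (intro has_sum_finite_neutralI[of "{j}"]) (auto simp: orthonormal_family_def)
qed

text \<open>The image has the same coefficients with respect to \<open>q\<close> as \<open>x\<close>
  has with respect to \<open>p\<close>. As the sum does not mention \<open>q\<close>, images under
  different target families have equal norms.\<close>

lemma transfer_op_norm:
  assumes p: "bessel p" and q: "orthonormal_family q"
  shows "((\<lambda>i. (cmod (cinner x (p i)))\<^sup>2) has_sum (norm (transfer_op p q x))\<^sup>2) UNIV"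
proof -
  let ?y = "transfer_op p q x"
  have "((\<lambda>i. cinner x (p i) * cinner (q i) ?y) has_sum cinner ?y ?y) UNIV"
    by (rule cinner_transfer_op_has_sum[OF p orthonormal_family_imp_bessel[OF q]])
  also have "(\<lambda>i. cinner x (p i) * cinner (q i) ?y) = (\<lambda>i. of_real ((cmod (cinner x (p i)))\<^sup>2))"
    by (subst (2) cinner_commute)
      (simp add: cinner_transfer_op_base[OF p q] complex_norm_square del: of_real_power)
  finally show ?thesis
    unfolding cinner_self has_sum_of_real_iff .
qed

text \<open>The range of \<open>transfer_op p q\<close> lies in the closed span of
  \<open>q\<close>.\<close>

lemma cinner_transfer_op_eq_0:
  fixes x :: "'a::complex_hilbert"
  assumes p: "bessel p" and q: "bessel q" and "\<And>j. cinner x (q j) = 0"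
  shows "cinner x (transfer_op p q y) = 0"
proof -
  have "cinner (transfer_op p q y) x = 0"
  proof (rule has_sum_unique[OF cinner_transfer_op_has_sum[OF p q]])
    show "((\<lambda>i. cinner y (p i) * cinner (q i) x) has_sum 0) UNIV"
      using assms(3) by (intro has_sum_0) (simp add: cinner_eq_0_commute[of "q _"])
  qed
  then show ?thesis by (simp add: cinner_eq_0_commute)
qed

text \<open>What remains of \<open>x\<close> after projection is orthogonal to the whole family, so
  \<open>x\<close> is its own projection and \<open>transfer_op_norm\<close> computes its
  norm.\<close>

lemma orthonormal_total_parseval:
  assumes e: "orthonormal_family e" and total: "\<And>x. (\<And>i. cinner x (e i) = 0) \<Longrightarrow> x = 0"
  shows "parseval_frame e"
  unfolding parseval_frame_def tight_frame_bound_def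
proof (intro conjI allI)
  fix x
  have "cinner (x - transfer_op e e x) (e i) = 0" for i
    by (simp add: cinner_diff_left cinner_transfer_op_base[OF orthonormal_family_imp_bessel[OF e] e])
  then have "x - transfer_op e e x = 0"
    by (rule total)
  then show "((\<lambda>i. (cmod (cinner x (e i)))\<^sup>2) has_sum 1 * (norm x)\<^sup>2) UNIV"
    using transfer_op_norm[OF orthonormal_family_imp_bessel[OF e] e, of x] by simp
qed simp

text \<open>The finite partial sums of the Parseval expansion of \<open>x\<close> lie in the span
  and converge to \<open>x\<close>.\<close>

lemma orthonormal_parseval_basis:
  assumes e: "orthonormal_family e" and "parseval_frame e"
  shows "orthonormal_basis e"
  unfolding orthonormal_basis_def
proof (intro conjI e set_eqI iffI UNIV_I)
  fix x
  have "((\<lambda>F. \<Sum>i\<in>F. cinner x (e i) *\<^sub>C e i) \<longlongrightarrow> x) (finite_subsets_at_top UNIV)"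
    using parseval_frame_expansion[OF assms(2)] by (simp add: has_sum_def)
  then show "x \<in> closure (complex_span e)"
  proof (rule Lim_in_closed_set[rotated 3])
    have "(\<Sum>i\<in>F. cinner x (e i) *\<^sub>C e i) \<in> complex_span e" if "finite F" for F
      using that by (auto simp: complex_span_def)
    then show "\<forall>\<^sub>F F in finite_subsets_at_top UNIV. (\<Sum>i\<in>F. cinner x (e i) *\<^sub>C e i) \<in> closure (complex_span e)"
      using closure_subset by (intro eventually_finite_subsets_at_top_weakI) blast
  qed auto
qed

subsection \<open>Maximal orthonormal sets\<close>

definition orthonormal_set :: "'a::complex_hilbert set \<Rightarrow> bool" where
  "orthonormal_set B \<longleftrightarrow> (\<forall>b\<in>B. \<forall>c\<in>B. cinner b c = (if b = c then 1 else 0))"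

text \<open>Zorn's lemma for orthonormal subsets of the orthogonal complement \<open>K\<close> of
  \<open>S\<close>: a nonzero vector orthogonal to \<open>S\<close> and \<open>B\<close> could be
  normalized and added to \<open>B\<close>. The case of empty \<open>S\<close> gives a basis of the
  whole space.\<close>

lemma maximal_orthonormal_set:
  fixes S :: "'a::complex_hilbert set"
  obtains B where "orthonormal_set B" "\<And>b s. b \<in> B \<Longrightarrow> s \<in> S \<Longrightarrow> cinner b s = 0"
    "\<And>x. (\<And>s. s \<in> S \<Longrightarrow> cinner x s = 0) \<Longrightarrow> (\<And>b. b \<in> B \<Longrightarrow> cinner x b = 0) \<Longrightarrow> x = 0"
proof -
  define K where "K = {x. \<forall>s\<in>S. cinner x s = 0}"
  define \<A> where "\<A> = {B. B \<subseteq> K \<and> orthonormal_set B}"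
  have "\<exists>M\<in>\<A>. \<forall>X\<in>\<A>. M \<subseteq> X \<longrightarrow> X = M"
  proof (rule subset_Zorn')
    fix C assume C: "subset.chain \<A> C"
    have "cinner b c = (if b = c then 1 else 0)" if "b \<in> \<Union>C" "c \<in> \<Union>C" for b c
    proof -
      obtain X where "X \<in> C" "b \<in> X" "c \<in> X"
        using \<open>b \<in> \<Union>C\<close> \<open>c \<in> \<Union>C\<close> C unfolding subset_chain_def by blast
      moreover have "X \<in> \<A>"
        using C \<open>X \<in> C\<close> unfolding subset_chain_def by blast
      ultimately show ?thesis
        by (simp add: \<A>_def orthonormal_set_def)
    qed
    moreover have "\<Union>C \<subseteq> K"
      using C by (auto simp: subset_chain_def \<A>_def)
    ultimately show "\<Union>C \<in> \<A>"
      by (simp add: \<A>_def orthonormal_set_def)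
  qed
  then obtain B where B: "B \<in> \<A>" and max: "\<And>X. X \<in> \<A> \<Longrightarrow> B \<subseteq> X \<Longrightarrow> X = B"
    by blast
  show ?thesis
  proof (rule that[of B])
    show "orthonormal_set B" "\<And>b s. b \<in> B \<Longrightarrow> s \<in> S \<Longrightarrow> cinner b s = 0"
      using B by (auto simp: \<A>_def K_def)
    fix x assume x: "\<And>s. s \<in> S \<Longrightarrow> cinner x s = 0" "\<And>b. b \<in> B \<Longrightarrow> cinner x b = 0"
    show "x = 0"
    proof (rule ccontr)
      assume "x \<noteq> 0"
      define y where "y = (1 / norm x) *\<^sub>R x"
      have y1: "cinner y y = 1"
        using \<open>x \<noteq> 0\<close> by (simp add: y_def cinner_self)
      have yB: "cinner y b = 0" "cinner b y = 0" if "b \<in> B" for b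
        using x(2)[OF that] cinner_eq_0_commute[of x b]
        by (simp_all add: y_def cinner_scaleR_left cinner_scaleR_right)
      have "insert y B \<in> \<A>"
        using B x(1) y1 yB by (auto simp: \<A>_def K_def orthonormal_set_def y_def cinner_scaleR_left)
      then have "y \<in> B" using max by blast
      then show False using y1 yB by force
    qed
  qed
qed

text \<open>If \<open>B\<close> were finite, exchanging summations would bound \<open>\<Sum>i. (norm (h i))\<^sup>2\<close> by \<open>card B\<close>.\<close>

lemma maximal_orthonormal_set_infinite:
  fixes S :: "'a::complex_hilbert set" and h :: "'i \<Rightarrow> 'a"
  assumes B: "orthonormal_set B" "\<And>b s. b \<in> B \<Longrightarrow> s \<in> S \<Longrightarrow> cinner b s = 0"
    and max: "\<And>x. (\<And>s. s \<in> S \<Longrightarrow> cinner x s = 0) \<Longrightarrow> (\<And>b. b \<in> B \<Longrightarrow> cinner x b = 0) \<Longrightarrow> x = 0"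
    and h: "\<And>i s. s \<in> S \<Longrightarrow> cinner (h i) s = 0"
    and norm_h: "\<And>i. (norm (h i))\<^sup>2 = r" "r > 0"
    and bound: "\<And>F b. finite F \<Longrightarrow> b \<in> B \<Longrightarrow> (\<Sum>i\<in>F. (cmod (cinner b (h i)))\<^sup>2) \<le> 1"
    and inf: "infinite (UNIV :: 'i set)"
  shows "infinite B"
proof
  assume fin: "finite B"
  \<comment> \<open>Maximality turns the finite set \<open>B\<close> into a basis of the complement
    of \<open>S\<close>: the remainder \<open>h i - p\<close> is orthogonal to both \<open>S\<close>
    and \<open>B\<close>.\<close>
  have expand: "h i = (\<Sum>b\<in>B. cinner (h i) b *\<^sub>C b)" for i
  proof -
    define p where "p = (\<Sum>b\<in>B. cinner (h i) b *\<^sub>C b)"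
    have "cinner p b = cinner (h i) b" if "b \<in> B" for b
    proof -
      have "cinner p b = (\<Sum>c\<in>B. if c = b then cinner (h i) c else 0)"
        unfolding p_def cinner_sum_left using that B(1)
        by (intro sum.cong) (auto simp: cinner_scaleC_left orthonormal_set_def)
      then show ?thesis using that fin by simp
    qed
    moreover have "cinner p s = 0" if "s \<in> S" for s
      using B(2) that by (simp add: p_def cinner_sum_left cinner_scaleC_left)
    ultimately have "h i - p = 0"
      using h by (intro max) (auto simp: cinner_diff_left)
    then show ?thesis by (simp add: p_def)
  qed
  have norm_eq: "(norm (h i))\<^sup>2 = (\<Sum>b\<in>B. (cmod (cinner b (h i)))\<^sup>2)" for i
  proof -
    have "cinner (h i) (h i) = (\<Sum>b\<in>B. cinner (h i) b * cinner b (h i))"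
      by (subst expand) (simp add: cinner_sum_left cinner_scaleC_left)
    also have "\<dots> = (\<Sum>b\<in>B. of_real ((cmod (cinner b (h i)))\<^sup>2))"
      by (intro sum.cong) (simp_all add: complex_norm_square cinner_commute[of "h i"] mult.commute
          del: of_real_power)
    finally show ?thesis
      unfolding cinner_self of_real_sum[symmetric] of_real_eq_iff .
  qed
  obtain N :: nat where N: "real (card B) < real N * r"
    using reals_Archimedean3[OF norm_h(2)] by blast
  obtain F :: "'i set" where F: "finite F" "card F = N"
    using infinite_arbitrarily_large[OF inf] by blast
  have "real N * r = (\<Sum>i\<in>F. \<Sum>b\<in>B. (cmod (cinner b (h i)))\<^sup>2)"
    using F norm_h(1) by (simp add: norm_eq[symmetric])
  also have "\<dots> = (\<Sum>b\<in>B. \<Sum>i\<in>F. (cmod (cinner b (h i)))\<^sup>2)"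
    by (rule sum.swap)
  also have "\<dots> \<le> (\<Sum>b\<in>B. 1)"
    by (intro sum_mono bound F(1))
  finally show False using N by simp
qed

lemma countable_bij_betw:
  fixes B :: "'a set"
  assumes "countable B" "infinite B" "infinite (UNIV :: 'i::countable set)"
  obtains u :: "'i::countable \<Rightarrow> 'a" where "bij_betw u UNIV B"
  using bij_betw_trans[OF to_nat_on_infinite[of "UNIV :: 'i set"] bij_betw_from_nat_into[of B]] assms
  by auto

text \<open>A maximal orthonormal set \<open>B\<close> is infinite because of
  \<open>\<omega>\<close> and countable because of \<open>g\<close>, so it can be indexed by the
  given index type.\<close>

lemma tight_frame_orthonormal_parseval:
  fixes g \<omega> :: "'i::countable \<Rightarrow> 'a::complex_hilbert"
  assumes inf: "infinite (UNIV :: 'i set)" and g: "tight_frame_bound A g"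
    and \<omega>: "orthonormal_family \<omega>"
  obtains u :: "'i \<Rightarrow> 'a" where "orthonormal_family u" "parseval_frame u"
proof -
  obtain B :: "'a set" where B: "orthonormal_set B"
      "\<And>x. (\<And>b. b \<in> B \<Longrightarrow> cinner x b = 0) \<Longrightarrow> x = 0"
    using maximal_orthonormal_set[of "{}"] by auto
  have "infinite B"
  proof (rule maximal_orthonormal_set_infinite[of B "{}" \<omega> 1])
    show "(norm (\<omega> i))\<^sup>2 = 1" for i
      using \<omega> norm_eq_1_of_cinner[of "\<omega> i"] by (simp add: orthonormal_family_def)
    show "(\<Sum>i\<in>F. (cmod (cinner b (\<omega> i)))\<^sup>2) \<le> 1" if "finite F" "b \<in> B" for F b
    proof -
      have "(norm b)\<^sup>2 = 1"
        using B(1) that norm_eq_1_of_cinner[of b] by (simp add: orthonormal_set_def)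
      then show ?thesis
        using orthonormal_family_imp_bessel[OF \<omega>] that by (auto simp: bessel_def dest: spec[of _ b])
    qed
  qed (use B inf in auto)
  \<comment> \<open>The coefficients of \<open>g i\<close> over \<open>B\<close> are square summable
    by Bessel, so only countably many are nonzero.\<close>
  have "countable {b \<in> B. cinner (g i) b \<noteq> 0}" for i
  proof -
    have "(\<lambda>b. (cmod (cinner (g i) b))\<^sup>2) summable_on B"
      by (intro nonneg_bdd_above_summable_on bdd_aboveI2[where M = "(norm (g i))\<^sup>2"])
        (use B(1) in \<open>auto intro!: orthonormal_on_bessel[of _ "\<lambda>b. b"] simp: orthonormal_set_def subset_iff\<close>)
    from summable_countable_real[OF this] show ?thesis by simp
  qed
  then have "countable (\<Union>i. {b \<in> B. cinner (g i) b \<noteq> 0})"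
    by simp
  \<comment> \<open>A unit vector orthogonal to every \<open>g i\<close> would contradict the frame
    identity.\<close>
  moreover have "B \<subseteq> (\<Union>i. {b \<in> B. cinner (g i) b \<noteq> 0})"
  proof
    fix b assume "b \<in> B"
    then have "b \<noteq> 0" using B(1) by (force simp: orthonormal_set_def)
    have "\<exists>i. cinner (g i) b \<noteq> 0"
    proof (rule ccontr)
      assume "\<not> ?thesis"
      then have "((\<lambda>i. (cmod (cinner b (g i)))\<^sup>2) has_sum 0) UNIV"
        by (intro has_sum_0) (simp add: cinner_eq_0_commute[of b])
      then show False
        using g \<open>b \<noteq> 0\<close> has_sum_unique unfolding tight_frame_bound_def
        by (metis less_irrefl mult_eq_0_iff norm_eq_zero power_eq_0_iff)
    qed
    with \<open>b \<in> B\<close> show "b \<in> (\<Union>i. {b \<in> B. cinner (g i) b \<noteq> 0})" by auto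
  qed
  ultimately have "countable B"
    by (rule countable_subset[rotated])
  then obtain u :: "'i \<Rightarrow> 'a" where u: "bij_betw u UNIV B"
    using countable_bij_betw \<open>infinite B\<close> inf by blast
  have uB: "u i \<in> B" "u i = u j \<longleftrightarrow> i = j" for i j
    using u by (auto simp: bij_betw_def inj_def)
  have on: "orthonormal_family u"
    using B(1) uB by (simp add: orthonormal_family_def orthonormal_set_def)
  moreover have "parseval_frame u"
    using u by (intro orthonormal_total_parseval on B(2)) (auto simp: bij_betw_def)
  ultimately show ?thesis by (rule that)
qed

subsection \<open>Weak R-duals of tight frames with redundancy\<close>

text \<open>The abstract core, free of Gabor structure. The bound on the norms of \<open>g\<close>
  leaves room outside the closed span of the coefficient vectors; the orthogonality of
  \<open>w\<close> lets an isometry carry \<open>w\<close> onto them.\<close>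

theorem tight_frame_weak_R_dual:
  fixes g w :: "'i::countable \<Rightarrow> 'a::complex_hilbert"
  assumes inf: "infinite (UNIV :: 'i set)" and g: "tight_frame_bound A g"
    and w: "\<And>i j. cinner (w i) (w j) = (if i = j then of_real A else 0)"
    and norm_g: "\<And>i. (norm (g i))\<^sup>2 = \<rho> * A" and "\<rho> < 1"
  shows "\<exists>u v. orthonormal_basis u \<and> parseval_frame v \<and> \<not> orthonormal_basis v \<and> weak_R_dual u v g w"
proof -
  have "A > 0" using g by (simp add: tight_frame_bound_def)
  define \<omega> where "\<omega> j = (1 / sqrt A) *\<^sub>R w j" for j
  have \<omega>: "orthonormal_family \<omega>"
    using \<open>A > 0\<close> w
    by (simp add: orthonormal_family_def \<omega>_def cinner_scaleR_left cinner_scaleR_right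
        flip: of_real_mult)
  obtain u :: "'i \<Rightarrow> 'a" where u: "orthonormal_family u" "parseval_frame u"
    using tight_frame_orthonormal_parseval[OF inf g \<omega>] .
  have bu: "bessel u" and b\<omega>: "bessel \<omega>"
    using u \<omega> by (auto intro: orthonormal_family_imp_bessel)
  have pol_u: "((\<lambda>i. cinner x (u i) * cinner (u i) y) has_sum cinner x y) UNIV" for x y
    using tight_frame_polarization[of 1 u x y] u(2) by (simp add: parseval_frame_def)
  have norm_u: "norm (u i) = 1" for i
    using u(1) by (intro norm_eq_1_of_cinner) (simp add: orthonormal_family_def)

  \<comment> \<open>The frame identity at the unit vector \<open>u j\<close>.\<close>
  have coeff: "((\<lambda>i. (cmod (cinner (g i) (u j)))\<^sup>2) has_sum A) UNIV" for j
    using g norm_u[of j] unfolding tight_frame_bound_def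
    by (auto simp: cinner_commute[of "g _"] dest: spec[of _ "u j"])
  \<comment> \<open>\<open>\<gamma> j\<close> represents the normalized coefficient sequence of
    \<open>u j\<close> in the coordinates of \<open>u\<close>; it is the intended image of
    \<open>\<omega> j\<close> under the isometry \<open>V\<close>.\<close>
  define c where "c j i = cinner (g i) (u j) / of_real (sqrt A)" for i j
  define \<gamma> where "\<gamma> j = (\<Sum>\<^sub>\<infinity>i. c j i *\<^sub>C u i)" for j
  have \<gamma>_sum: "((\<lambda>i. c j i *\<^sub>C u i) has_sum \<gamma> j) UNIV" for j
  proof -
    have "((\<lambda>i. (cmod (c j i))\<^sup>2) has_sum A / A) UNIV"
      using has_sum_divide_const[OF coeff, of j A] \<open>A > 0\<close>
      by (simp add: c_def norm_divide power_divide)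
    then show ?thesis
      unfolding \<gamma>_def by (intro has_sum_infsum bessel_synthesis_summable bu) (auto simp: summable_on_def)
  qed
  have \<gamma>_u: "cinner (\<gamma> j) (u i) = c j i" for i j
    using cinner_has_sum_left[OF \<gamma>_sum[of j], of "u i"]
  proof (rule has_sum_unique)
    show "((\<lambda>k. c j k * cinner (u k) (u i)) has_sum c j i) UNIV"
      by (rule has_sum_finite_neutralI[of "{i}"]) (use u(1) in \<open>auto simp: orthonormal_family_def\<close>)
  qed
  \<comment> \<open>Expanding in the basis \<open>u\<close> turns this inner product into the
    polarized frame identity of \<open>g\<close> at \<open>u k\<close> and \<open>u j\<close>;
    conjugation swaps the two indices.\<close>
  have "cinner (\<gamma> j) (\<gamma> k) = cinner (u k) (u j)" for j k
  proof (rule has_sum_unique[OF pol_u])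
    have "((\<lambda>i. cinner (u k) (g i) * cinner (g i) (u j) / of_real A) has_sum
        of_real A * cinner (u k) (u j) / of_real A) UNIV"
      by (intro has_sum_divide_const tight_frame_polarization g)
    moreover have "cinner (\<gamma> j) (u i) * cinner (u i) (\<gamma> k)
        = cinner (u k) (g i) * cinner (g i) (u j) / of_real A" for i
      using \<open>A > 0\<close>
      by (simp add: cinner_commute[of "u i" "\<gamma> k"] cinner_commute[of "u k"] \<gamma>_u c_def
          flip: of_real_mult)
    ultimately show "((\<lambda>i. cinner (\<gamma> j) (u i) * cinner (u i) (\<gamma> k)) has_sum cinner (u k) (u j)) UNIV"
      using \<open>A > 0\<close> by simp
  qed
  then have \<gamma>: "orthonormal_family \<gamma>"
    using u(1) by (auto simp: orthonormal_family_def)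
  then have b\<gamma>: "bessel \<gamma>"
    by (rule orthonormal_family_imp_bessel)

  obtain B where B: "orthonormal_set B" "\<And>b s. b \<in> B \<Longrightarrow> s \<in> range \<gamma> \<Longrightarrow> cinner b s = 0"
    "\<And>x. (\<And>s. s \<in> range \<gamma> \<Longrightarrow> cinner x s = 0) \<Longrightarrow> (\<And>b. b \<in> B \<Longrightarrow> cinner x b = 0) \<Longrightarrow> x = 0"
    using maximal_orthonormal_set[of "range \<gamma>"] by blast
  \<comment> \<open>Each \<open>u i\<close> has distance \<open>sqrt (1 - \<rho>)\<close> to the closed span of \<open>\<gamma>\<close>, which therefore has
    infinite codimension.\<close>
  define h where "h i = u i - transfer_op \<gamma> \<gamma> (u i)" for i
  have h\<gamma>: "cinner (h i) (\<gamma> j) = 0" for i j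
    by (simp add: h_def cinner_diff_left cinner_transfer_op_base[OF b\<gamma> \<gamma>])
  have norm_h: "(norm (h i))\<^sup>2 = 1 - \<rho>" for i
  proof -
    \<comment> \<open>The same matrix is now summed over the other index: Parseval for
      \<open>u\<close> at \<open>g i\<close> gives the squared norm of the projection of
      \<open>u i\<close> as \<open>(norm (g i))\<^sup>2 / A\<close>, which is
      \<open>\<rho>\<close>.\<close>
    have "((\<lambda>j. (cmod (cinner (g i) (u j)))\<^sup>2 / A) has_sum (norm (g i))\<^sup>2 / A) UNIV"
      using u(2) by (intro has_sum_divide_const) (simp add: parseval_frame_def tight_frame_bound_def)
    also have "(\<lambda>j. (cmod (cinner (g i) (u j)))\<^sup>2 / A) = (\<lambda>j. (cmod (cinner (u i) (\<gamma> j)))\<^sup>2)"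
      using \<open>A > 0\<close>
      by (simp add: cinner_commute[of "u i"] \<gamma>_u c_def norm_divide power_divide)
    finally have "(norm (transfer_op \<gamma> \<gamma> (u i)))\<^sup>2 = \<rho>"
      using has_sum_unique[OF transfer_op_norm[OF b\<gamma> \<gamma>, of "u i"]] norm_g[of i] \<open>A > 0\<close> by simp
    moreover have "cinner (h i) (transfer_op \<gamma> \<gamma> (u i)) = 0"
      by (rule cinner_transfer_op_eq_0[OF b\<gamma> b\<gamma> h\<gamma>])
    from norm_add_orthogonal[OF this]
    have "(norm (u i))\<^sup>2 = (norm (h i))\<^sup>2 + (norm (transfer_op \<gamma> \<gamma> (u i)))\<^sup>2"
      by (simp add: h_def)
    ultimately show ?thesis using norm_u[of i] by simp
  qed
  have "infinite B"
  proof (rule maximal_orthonormal_set_infinite[OF B _ norm_h _ _ inf])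
    show "cinner (h i) s = 0" if "s \<in> range \<gamma>" for i s
      using that h\<gamma> by auto
    show "0 < 1 - \<rho>" using \<open>\<rho> < 1\<close> by simp
    fix F :: "'i set" and b assume F: "finite F" and b: "b \<in> B"
    \<comment> \<open>As \<open>b\<close> is orthogonal to \<open>\<gamma>\<close>, it does not see
      the projected part, and Bessel for \<open>u\<close> provides the bound.\<close>
    have "cinner b (h i) = cinner b (u i)" for i
      unfolding h_def cinner_diff_right
      using cinner_transfer_op_eq_0[OF b\<gamma> b\<gamma>, of b "u i"] B(2)[OF b] by simp
    moreover have "(norm b)\<^sup>2 = 1"
      using B(1) b norm_eq_1_of_cinner[of b] by (simp add: orthonormal_set_def)
    ultimately show "(\<Sum>i\<in>F. (cmod (cinner b (h i)))\<^sup>2) \<le> 1"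
      using bu F by (auto simp: bessel_def dest: spec[of _ b])
  qed
  then obtain \<beta> :: "nat \<Rightarrow> 'a" where \<beta>: "inj \<beta>" "range \<beta> \<subseteq> B"
    using infinite_countable_subset by blast
  \<comment> \<open>Leaving out \<open>\<beta> 0\<close> is what prevents \<open>v\<close> from being an orthonormal basis.\<close>
  define d where "d i = \<beta> (Suc (to_nat i))" for i :: 'i
  define z where "z = \<beta> 0"
  have \<beta>_on: "cinner (\<beta> m) (\<beta> n) = (if m = n then 1 else 0)" for m n
  proof -
    have "\<beta> m \<in> B" "\<beta> n \<in> B" using \<beta>(2) by auto
    then show ?thesis
      using B(1) \<beta>(1) by (simp add: orthonormal_set_def inj_eq)
  qed
  have \<beta>_\<gamma>: "cinner (\<beta> n) (\<gamma> j) = 0" for n j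
    using \<beta> B(2) by blast
  have d: "orthonormal_family d"
    by (simp add: orthonormal_family_def d_def \<beta>_on)
  then have bd: "bessel d" by (rule orthonormal_family_imp_bessel)

  \<comment> \<open>\<open>Q\<close> projects onto the complement of \<open>\<omega>\<close>.
    \<open>V\<close> sends \<open>\<omega> j\<close> to \<open>\<gamma> j\<close> and embeds that
    complement isometrically into the span of \<open>d\<close>, orthogonally to
    \<open>\<gamma>\<close>; \<open>v i\<close> is the adjoint of \<open>V\<close> applied to
    \<open>u i\<close>.\<close>
  define Q where "Q x = x - transfer_op \<omega> \<omega> x" for x
  define V where "V x = transfer_op \<omega> \<gamma> x + transfer_op u d (Q x)" for x
  define v where "v i = transfer_op \<gamma> \<omega> (u i) + Q (transfer_op d u (u i))" for i
  have Q_adj: "cinner (Q x) y = cinner x (Q y)" for x y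
    by (simp add: Q_def cinner_diff_left cinner_diff_right cinner_transfer_op_commute[OF b\<omega> b\<omega>])
  have V_v: "cinner x (v i) = cinner (V x) (u i)" for x i
    unfolding V_def v_def cinner_add_left cinner_add_right
    by (simp add: Q_adj[symmetric] cinner_transfer_op_commute[OF b\<omega> b\<gamma>]
        cinner_transfer_op_commute[OF bu bd])
  \<comment> \<open>The two summands of \<open>V x\<close> are orthogonal, and their norms are those
    of the two orthogonal components of \<open>x\<close>.\<close>
  have norm_V: "norm (V x) = norm x" for x
  proof -
    have Q\<omega>: "cinner (Q x) (\<omega> j) = 0" for j
      by (simp add: Q_def cinner_diff_left cinner_transfer_op_base[OF b\<omega> \<omega>])
    have "cinner (transfer_op \<omega> \<gamma> x) (d k) = 0" for k
      using cinner_transfer_op_eq_0[OF b\<omega> b\<gamma>, of "d k" x] \<beta>_\<gamma>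
      by (simp add: d_def cinner_eq_0_commute)
    then have "cinner (transfer_op \<omega> \<gamma> x) (transfer_op u d (Q x)) = 0"
      by (rule cinner_transfer_op_eq_0[OF bu bd])
    then have "(norm (V x))\<^sup>2 = (norm (transfer_op \<omega> \<gamma> x))\<^sup>2 + (norm (transfer_op u d (Q x)))\<^sup>2"
      unfolding V_def by (rule norm_add_orthogonal)
    also have "(norm (transfer_op \<omega> \<gamma> x))\<^sup>2 = (norm (transfer_op \<omega> \<omega> x))\<^sup>2"
      by (rule has_sum_unique[OF transfer_op_norm[OF b\<omega> \<gamma>] transfer_op_norm[OF b\<omega> \<omega>]])
    also have "(norm (transfer_op u d (Q x)))\<^sup>2 = (norm (Q x))\<^sup>2"
      by (rule has_sum_unique[OF transfer_op_norm[OF bu d]])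
        (use u(2) in \<open>simp add: parseval_frame_def tight_frame_bound_def\<close>)
    also have "(norm (transfer_op \<omega> \<omega> x))\<^sup>2 + (norm (Q x))\<^sup>2 = (norm x)\<^sup>2"
      using norm_add_orthogonal[OF cinner_transfer_op_eq_0[OF b\<omega> b\<omega> Q\<omega>], of x]
      by (simp add: Q_def)
    finally show ?thesis by simp
  qed
  have v: "parseval_frame v"
    unfolding parseval_frame_def tight_frame_bound_def
  proof (intro conjI allI)
    show "((\<lambda>i. (cmod (cinner x (v i)))\<^sup>2) has_sum 1 * (norm x)\<^sup>2) UNIV" for x
      using u(2) unfolding V_v parseval_frame_def tight_frame_bound_def
      by (metis norm_V)
  qed simp
  \<comment> \<open>Since \<open>V\<close> maps \<open>\<omega> j\<close> to
    \<open>\<gamma> j\<close>, the \<open>v\<close>-coefficients of \<open>w j\<close> are exactly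
    those prescribed for a weak R-dual.\<close>
  have w_v: "cinner (w j) (v i) = cinner (g i) (u j)" for i j
  proof -
    have w_\<omega>: "w j = of_real (sqrt A) *\<^sub>C \<omega> j"
      using \<open>A > 0\<close> by (simp add: \<omega>_def flip: scaleR_scaleC)
    have "Q (\<omega> j) = 0"
      by (simp add: Q_def transfer_op_base[OF \<omega> b\<omega>])
    then have "cinner (V (\<omega> j)) (u i) = c j i"
      by (simp add: V_def cinner_add_left transfer_op_base[OF \<omega> b\<gamma>] \<gamma>_u
          cinner_transfer_op_commute[OF bu bd])
    then show ?thesis
      using \<open>A > 0\<close> V_v[of "\<omega> j" i] by (simp add: w_\<omega> cinner_scaleC_left c_def)
  qed
  have "\<not> orthonormal_basis v"
  proof
    assume "orthonormal_basis v"
    then have on: "cinner (v i) (v j) = (if i = j then 1 else 0)" for i j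
      by (simp add: orthonormal_basis_def orthonormal_family_def)
    \<comment> \<open>Orthonormality of \<open>v\<close> would give \<open>V (v i) = u i\<close>,
      putting the whole basis \<open>u\<close> into the range of \<open>V\<close>, which is
      orthogonal to \<open>z\<close>.\<close>
    have "cinner (u i) z = 0" for i
    proof -
      have "cinner (V (v i) - u i) (u j) = 0" for j
        using on[of i j] u(1) by (simp add: cinner_diff_left V_v[symmetric] orthonormal_family_def)
      then have "cinner (V (v i) - u i) (V (v i) - u i) = 0"
        by (intro has_sum_unique[OF pol_u] has_sum_0) simp
      then have "u i = V (v i)" by simp
      moreover have "cinner z (transfer_op \<omega> \<gamma> x) = 0" "cinner z (transfer_op u d x) = 0" for x
        using cinner_transfer_op_eq_0[OF b\<omega> b\<gamma>, of z] cinner_transfer_op_eq_0[OF bu bd, of z]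
        by (simp_all add: z_def d_def \<beta>_on \<beta>_\<gamma>)
      then have "cinner z (V x) = 0" for x
        by (simp add: V_def cinner_add_right)
      ultimately show ?thesis
        by (metis cinner_eq_0_commute)
    qed
    then have "cinner z z = 0"
      by (intro has_sum_unique[OF pol_u] has_sum_0) simp
    then show False
      by (simp add: z_def \<beta>_on del: cinner_self_eq_0)
  qed
  moreover have "weak_R_dual u v g w"
    unfolding weak_R_dual_def
  proof (intro conjI allI u(2) v)
    show "(\<lambda>i. (cmod (cinner (g i) (u j)))\<^sup>2) summable_on UNIV" for j
      using coeff by (auto simp: summable_on_def)
    \<comment> \<open>By \<open>w_v\<close> this is the polarized Parseval identity of
      \<open>v\<close> at \<open>w j\<close> and \<open>v i\<close>.\<close>
    show "((\<lambda>k. cinner (v k) (v i) * cinner (g k) (u j)) has_sum cinner (g i) (u j)) UNIV" for i j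
      using tight_frame_polarization[of 1 v "w j" "v i"] v
      by (simp add: parseval_frame_def w_v mult.commute)
    show "((\<lambda>i. cinner (g i) (u j) *\<^sub>C v i) has_sum w j) UNIV" for j
      using parseval_frame_expansion[OF v, of "w j"] by (simp add: w_v)
  qed
  ultimately show ?thesis
    using orthonormal_parseval_basis[OF u] v by blast
qed

subsection \<open>Characters\<close>

definition chi :: "real \<Rightarrow> real \<Rightarrow> complex" where
  "chi x t = exp (2 * of_real pi * \<i> * of_real x * of_real t)"

lemma chi_add_left: "chi (x + y) t = chi x t * chi y t"
  by (simp add: chi_def exp_add[symmetric] algebra_simps)

lemma chi_add_right: "chi x (t + s) = chi x t * chi x s"
  by (simp add: chi_def exp_add[symmetric] algebra_simps)

lemma cnj_chi: "cnj (chi x t) = chi (- x) t"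
  by (simp add: chi_def exp_cnj)

lemma chi_0 [simp]: "chi 0 t = 1" "chi x 0 = 1"
  by (simp_all add: chi_def)

lemma norm_chi [simp]: "cmod (chi x t) = 1"
  by (simp add: chi_def norm_exp_eq_Re)

lemma chi_eq_1_iff: "chi x t = 1 \<longleftrightarrow> x * t \<in> \<int>"
proof -
  have "chi x t = 1 \<longleftrightarrow> (\<exists>n::int. 2 * pi * (x * t) = of_int (2 * n) * pi)"
    by (simp add: chi_def exp_eq_1 mult.assoc)
  also have "\<dots> \<longleftrightarrow> (\<exists>n::int. x * t = of_int n)"
    by (intro ex_cong1) auto
  finally show ?thesis by (auto simp: Ints_def)
qed

lemma continuous_chi: "continuous_on A (chi x)"
  unfolding chi_def by (intro continuous_intros)

lemma measurable_chi [measurable]: "chi x \<in> borel_measurable borel"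
  by (intro borel_measurable_continuous_onI continuous_chi)

subsection \<open>Completeness of the trigonometric system\<close>

text \<open>All Fourier coefficients at frequencies in \<open>b\<close> times the integers vanish.
  The support is restricted only later, so the class is stable under multiplication by these
  exponentials.\<close>

definition null_spectrum :: "real \<Rightarrow> (real \<Rightarrow> complex) \<Rightarrow> bool" where
  "null_spectrum b k \<longleftrightarrow> integrable lborel k \<and> (\<forall>m::int. (\<integral>t. chi (of_int m * b) t * k t \<partial>lborel) = 0)"

lemma integrable_bounded_mult:
  fixes k g :: "real \<Rightarrow> complex"
  assumes "integrable lborel k" and [measurable]: "g \<in> borel_measurable borel" and "\<And>t. cmod (g t) \<le> C"
  shows "integrable lborel (\<lambda>t. g t * k t)"
proof (rule Bochner_Integration.integrable_bound)
  show "integrable lborel (\<lambda>t. C * cmod (k t))"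
    using assms(1) by (intro integrable_mult_right integrable_norm)
  have "0 \<le> C" using assms(3)[of 0] norm_ge_zero[of "g 0"] by linarith
  then show "AE t in lborel. norm (g t * k t) \<le> norm (C * cmod (k t))"
    using assms(3) by (auto simp: norm_mult intro!: mult_right_mono)
qed (use assms(1) in auto)

lemma null_spectrum_add:
  "null_spectrum b k \<Longrightarrow> null_spectrum b l \<Longrightarrow> null_spectrum b (\<lambda>t. k t + l t)"
  unfolding null_spectrum_def
  by (auto simp: distrib_left integrable_bounded_mult[where C = 1])

lemma null_spectrum_cmult:
  "null_spectrum b k \<Longrightarrow> null_spectrum b (\<lambda>t. c * k t)"
  unfolding null_spectrum_def by (auto simp: mult.left_commute[of _ c])

lemma null_spectrum_shift:
  assumes "null_spectrum b k"
  shows "null_spectrum b (\<lambda>t. chi (of_int n * b) t * k t)"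
  unfolding null_spectrum_def
proof (intro conjI allI)
  show "integrable lborel (\<lambda>t. chi (of_int n * b) t * k t)"
    using assms by (intro integrable_bounded_mult[where C = 1]) (auto simp: null_spectrum_def)
  fix m :: int
  have "(\<integral>t. chi (of_int m * b) t * (chi (of_int n * b) t * k t) \<partial>lborel)
      = (\<integral>t. chi (of_int (m + n) * b) t * k t \<partial>lborel)"
    by (simp add: distrib_right chi_add_left mult.assoc)
  also have "\<dots> = 0"
    using assms unfolding null_spectrum_def by blast
  finally show "(\<integral>t. chi (of_int m * b) t * (chi (of_int n * b) t * k t) \<partial>lborel) = 0" .
qed

text \<open>On the circle a real polynomial in the coordinates is a trigonometric polynomial, and
  multiplying by \<open>z\<close> or its conjugate merely shifts frequencies.\<close>

lemma null_spectrum_polynomial: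
  assumes "real_polynomial_function P" "null_spectrum b k"
  shows "null_spectrum b (\<lambda>t. of_real (P (chi b t)) * k t)"
  using assms
proof (induction arbitrary: k rule: real_polynomial_function.induct)
  case (linear f)
  interpret f: bounded_linear f by fact
  \<comment> \<open>A real-linear functional on the complex plane splits into a complex-linear and
    an antilinear part with these coefficients.\<close>
  define \<alpha> where "\<alpha> = (of_real (f 1) - \<i> * of_real (f \<i>)) / 2"
  define \<beta> where "\<beta> = (of_real (f 1) + \<i> * of_real (f \<i>)) / 2"
  have *: "complex_of_real (f z) = \<alpha> * z + \<beta> * cnj z" for z
  proof -
    have "z = Re z *\<^sub>R 1 + Im z *\<^sub>R \<i>"
      by (simp add: complex_eq_iff)
    then have "f z = f (Re z *\<^sub>R 1 + Im z *\<^sub>R \<i>)"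
      by (rule arg_cong)
    also have "\<dots> = Re z * f 1 + Im z * f \<i>"
      by (simp only: f.add f.scaleR real_scaleR_def)
    finally show ?thesis
      by (simp add: complex_eq_iff \<alpha>_def \<beta>_def field_simps)
  qed
  have "null_spectrum b (\<lambda>t. \<alpha> * (chi (of_int 1 * b) t * k t) + \<beta> * (chi (of_int (-1) * b) t * k t))"
    by (intro null_spectrum_add null_spectrum_cmult null_spectrum_shift linear.prems)
  then show ?case
    unfolding * by (simp add: cnj_chi distrib_right mult.assoc)
next
  case (const c)
  then show ?case by (rule null_spectrum_cmult)
next
  case (add f g)
  then show ?case
    using null_spectrum_add[OF add.IH(1)[OF add.prems] add.IH(2)[OF add.prems]]
    by (simp add: distrib_right)
next
  case (mult f g)
  then show ?case
    using mult.IH(1)[OF mult.IH(2)[OF mult.prems]] by (simp add: mult.assoc)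
qed

text \<open>Stone-Weierstrass on the unit circle: an approximation error below \<open>e\<close>
  changes the integral by at most \<open>e\<close> times the L1 norm of \<open>k\<close>.\<close>

lemma null_spectrum_continuous:
  fixes \<phi> :: "complex \<Rightarrow> real"
  assumes k: "null_spectrum b k" and \<phi>: "continuous_on UNIV \<phi>"
  shows "(\<integral>t. of_real (\<phi> (chi b t)) * k t \<partial>lborel) = 0"
proof -
  have ik: "integrable lborel k" using k by (simp add: null_spectrum_def)
  have [measurable]: "\<phi> \<in> borel_measurable borel"
    using \<phi> by (rule borel_measurable_continuous_onI)
  have cpt: "compact (sphere 0 1 :: complex set)" by simp
  have chi_sphere: "chi b t \<in> sphere 0 1" for t by simp
  have bound: "cmod (\<integral>t. of_real (\<phi> (chi b t)) * k t \<partial>lborel) \<le> e * (\<integral>t. cmod (k t) \<partial>lborel)"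
    if "e > 0" for e
  proof -
    obtain P where P: "real_polynomial_function P" "\<And>z. z \<in> sphere 0 1 \<Longrightarrow> \<bar>\<phi> z - P z\<bar> < e"
      using Stone_Weierstrass_real_polynomial_function[OF cpt continuous_on_subset[OF \<phi>] \<open>e > 0\<close>]
      by blast
    define r where "r t = complex_of_real (\<phi> (chi b t)) - of_real (P (chi b t))" for t
    have [measurable]: "P \<in> borel_measurable borel"
      by (intro borel_measurable_continuous_onI continuous_on_polymonial_function)
         (simp add: P(1) flip: real_polynomial_function_eq)
    have r: "cmod (r t) \<le> e" for t
      using P(2)[OF chi_sphere, of t] by (simp add: r_def flip: of_real_diff)
    have [measurable]: "r \<in> borel_measurable borel" unfolding r_def by measurable
    have ns: "null_spectrum b (\<lambda>t. of_real (P (chi b t)) * k t)"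
      by (rule null_spectrum_polynomial[OF P(1) k])
    have "(\<integral>t. of_real (P (chi b t)) * k t \<partial>lborel) = 0"
      using ns[unfolded null_spectrum_def, THEN conjunct2, rule_format, of 0] by simp
    moreover have ir: "integrable lborel (\<lambda>t. r t * k t)"
      using r by (intro integrable_bounded_mult[OF ik]) auto
    moreover have "(\<integral>t. of_real (\<phi> (chi b t)) * k t \<partial>lborel)
        = (\<integral>t. r t * k t + of_real (P (chi b t)) * k t \<partial>lborel)"
      by (intro Bochner_Integration.integral_cong) (auto simp: r_def algebra_simps)
    ultimately have "(\<integral>t. of_real (\<phi> (chi b t)) * k t \<partial>lborel) = (\<integral>t. r t * k t \<partial>lborel)"
      using ns by (simp add: null_spectrum_def)
    also have "cmod \<dots> \<le> (\<integral>t. e * cmod (k t) \<partial>lborel)"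
      by (rule Bochner_Integration.integral_norm_bound_integral[OF ir])
        (use r ik in \<open>auto simp: norm_mult intro!: mult_right_mono\<close>)
    finally show ?thesis by simp
  qed
  have "cmod (\<integral>t. of_real (\<phi> (chi b t)) * k t \<partial>lborel) \<le> 0"
  proof (rule field_le_epsilon)
    fix e :: real assume "e > 0"
    define I where "I = (\<integral>t. cmod (k t) \<partial>lborel)"
    have "I \<ge> 0" by (simp add: I_def)
    then have "e / (I + 1) * I \<le> e" "e / (I + 1) > 0"
      using \<open>e > 0\<close> by (simp_all add: field_simps)
    then show "cmod (\<integral>t. of_real (\<phi> (chi b t)) * k t \<partial>lborel) \<le> 0 + e"
      using bound[of "e / (I + 1)"] unfolding I_def by linarith
  qed
  then show ?thesis by simp
qed

text \<open>The indicator function of an arc is a limit of continuous functions on the circle.\<close>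

lemma null_spectrum_interval:
  assumes k: "null_spectrum b k" and "b > 0" and supp: "\<And>t. t \<notin> {0..<1/b} \<Longrightarrow> k t = 0"
  shows "(LINT t:{p..q}|lborel. k t) = 0"
proof -
  have ik [measurable]: "integrable lborel k" using k by (simp add: null_spectrum_def)
  \<comment> \<open>Clipping to the closed period keeps the arc \<open>S\<close> compact.\<close>
  define p' q' where "p' = max p 0" and "q' = min q (1 / b)"
  have restrict: "indicator {p..q} t *\<^sub>R k t = indicator {p'..q'} t *\<^sub>R k t" for t
    using supp[of t] by (auto simp: indicator_def p'_def q'_def)
  show ?thesis
  proof (cases "p' \<le> q'")
    case False
    then show ?thesis
      unfolding set_lebesgue_integral_def restrict by simp
  next
    case True
    define S where "S = chi b ` {p'..q'}"
    have S: "closed S" "S \<noteq> {}"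
      using True by (auto simp: S_def intro!: compact_imp_closed compact_continuous_image continuous_chi)
    have [measurable]: "S \<in> sets borel"
      using S(1) by (rule borel_closed)
    \<comment> \<open>The endpoints are excluded because \<open>0\<close> and \<open>1 / b\<close>
      give the same point of the circle; this costs only a null set.\<close>
    have chi_S: "chi b t \<in> S \<longleftrightarrow> t \<in> {p'..q'}" if "0 < t" "t < 1 / b" for t
    proof
      assume "chi b t \<in> S"
      then obtain s where s: "s \<in> {p'..q'}" "chi b t = chi b s" by (auto simp: S_def)
      have "chi b t * chi b (- s) = 1"
        unfolding s(2) by (simp flip: chi_add_right)
      then have "b * (t - s) \<in> \<int>"
        by (simp flip: chi_add_right add: chi_eq_1_iff)
      then obtain n :: int where n: "b * (t - s) = of_int n" by (auto simp: Ints_def)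
      have "0 < b * t" "b * t < 1" "0 \<le> b * s" "b * s \<le> 1"
        using that s(1) \<open>b > 0\<close> by (auto simp: p'_def q'_def field_simps)
      then have "\<bar>b * (t - s)\<bar> < 1" by (simp add: right_diff_distrib)
      then have "n = 0" unfolding n by simp
      then show "t \<in> {p'..q'}" using n s(1) \<open>b > 0\<close> by simp
    qed (auto simp: S_def)
    \<comment> \<open>The limit is the indicator of the complement of \<open>S\<close>, so the
      integral over the arc is the total integral minus a limit of zeros. The total is the
      coefficient at frequency 0.\<close>
    define \<phi> where "\<phi> n z = min 1 (real n * infdist z S)" for n z
    have \<phi>_cont: "continuous_on UNIV (\<phi> n)" for n
      unfolding \<phi>_def by (intro continuous_intros)
    have [measurable]: "\<phi> n \<in> borel_measurable borel" for n
      using \<phi>_cont by (rule borel_measurable_continuous_onI)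
    have \<phi>_lim: "(\<lambda>n. \<phi> n z) \<longlonglongrightarrow> (if z \<in> S then 0 else 1)" for z
    proof (cases "z \<in> S")
      case False
      then have d: "infdist z S > 0"
        using S infdist_nonneg[of z S] in_closed_iff_infdist_zero[OF S] by fastforce
      then obtain N where N: "real N * infdist z S > 1"
        using reals_Archimedean3 by blast
      have "\<phi> n z = 1" if "n \<ge> N" for n
      proof -
        have "real N * infdist z S \<le> real n * infdist z S"
          using that d by (intro mult_right_mono) auto
        then show ?thesis using N by (simp add: \<phi>_def)
      qed
      then show ?thesis
        using False by (intro tendsto_eventually eventually_sequentiallyI[of N]) simp
    qed (simp add: \<phi>_def)
    have \<phi>_bound: "\<bar>\<phi> n z\<bar> \<le> 1" for n z
      by (simp add: \<phi>_def infdist_nonneg abs_le_iff min_def)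
    have "(\<lambda>n. \<integral>t. of_real (\<phi> n (chi b t)) * k t \<partial>lborel)
        \<longlonglongrightarrow> (\<integral>t. of_real (if chi b t \<in> S then 0 else 1) * k t \<partial>lborel)"
    proof (rule integral_dominated_convergence[where w = "\<lambda>t. cmod (k t)"])
      show "(\<lambda>t. complex_of_real (if chi b t \<in> S then 0 else 1) * k t) \<in> borel_measurable lborel"
        by measurable
      show "AE t in lborel. (\<lambda>n. of_real (\<phi> n (chi b t)) * k t)
          \<longlonglongrightarrow> of_real (if chi b t \<in> S then 0 else 1) * k t"
        by (intro AE_I2 tendsto_intros \<phi>_lim)
      show "AE t in lborel. cmod (of_real (\<phi> n (chi b t)) * k t) \<le> cmod (k t)" for n
        using \<phi>_bound by (intro AE_I2) (simp add: norm_mult mult_left_le_one_le)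
      show "integrable lborel (\<lambda>t. cmod (k t))"
        using ik by (rule integrable_norm)
    qed measurable
    then have "(\<integral>t. of_real (if chi b t \<in> S then 0 else 1) * k t \<partial>lborel) = 0"
      by (simp only: null_spectrum_continuous[OF k \<phi>_cont] LIMSEQ_const_iff)
    also have "(\<integral>t. of_real (if chi b t \<in> S then 0 else 1) * k t \<partial>lborel)
        = (\<integral>t. k t - indicator {p'..q'} t *\<^sub>R k t \<partial>lborel)"
    proof (rule integral_cong_AE)
      show "AE t in lborel. of_real (if chi b t \<in> S then 0 else 1) * k t = k t - indicator {p'..q'} t *\<^sub>R k t"
        using AE_lborel_singleton[of 0]
      proof eventually_elim
        case (elim t)
        then show ?case
          using supp[of t] chi_S[of t] by (cases "t \<in> {0..<1/b}") auto
      qed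
    next
      show "(\<lambda>t. complex_of_real (if chi b t \<in> S then 0 else 1) * k t) \<in> borel_measurable lborel"
        by measurable
    qed (use ik in measurable)
    also have "\<dots> = (\<integral>t. k t \<partial>lborel) - (\<integral>t. indicator {p'..q'} t *\<^sub>R k t \<partial>lborel)"
      using ik by (intro Bochner_Integration.integral_diff integrable_mult_indicator) auto
    also have "(\<integral>t. k t \<partial>lborel) = 0"
      using k[unfolded null_spectrum_def, THEN conjunct2, rule_format, of 0] by simp
    finally show ?thesis
      unfolding set_lebesgue_integral_def restrict by simp
  qed
qed

text \<open>Integrals over intervals vanish, hence by induction over the Borel sets so do integrals
  over all of them; uniqueness of densities then treats real and imaginary parts.\<close>

lemma null_spectrum_imp_AE_zero:
  assumes k: "null_spectrum b k" and b: "b > 0" and supp: "\<And>t. t \<notin> {0..<1/b} \<Longrightarrow> k t = 0"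
  shows "AE t in lborel. k t = 0"
proof -
  have ik: "integrable lborel k" using k by (simp add: null_spectrum_def)
  have si: "set_integrable lborel A k" if "A \<in> sets borel" for A
    using that ik unfolding set_integrable_def by (intro integrable_mult_indicator) auto
  have zero: "(LINT t:A|lborel. k t) = 0" if "A \<in> sets borel" for A
    using that
  proof (induction rule: borel_set_induct)
    case (interval p q)
    show ?case by (rule null_spectrum_interval[OF k b supp])
  next
    case (compl A)
    have "(LINT t:-A|lborel. k t) = (\<integral>t. k t - indicator A t *\<^sub>R k t \<partial>lborel)"
      unfolding set_lebesgue_integral_def
      by (intro Bochner_Integration.integral_cong) (auto simp: indicator_def)
    also have "\<dots> = (\<integral>t. k t \<partial>lborel) - (LINT t:A|lborel. k t)"
      using ik si[OF compl(1)] unfolding set_lebesgue_integral_def set_integrable_def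
      by (intro Bochner_Integration.integral_diff)
    also have "(\<integral>t. k t \<partial>lborel) = 0"
      using k[unfolded null_spectrum_def, THEN conjunct2, rule_format, of 0] by simp
    finally show ?case using compl(2) by simp
  next
    case (union A)
    have "(LINT t:(\<Union>i. A i)|lborel. k t) = (\<Sum>i. (LINT t:A i|lborel. k t))"
      using union(1,2)
      by (intro lebesgue_integral_countable_add si) (auto simp: disjoint_family_on_def)
    then show ?case using union(3) by simp
  qed (simp add: set_lebesgue_integral_def)
  have "AE t in lborel. Re (k t) = 0"
  proof (rule density_unique_real)
    fix A :: "real set" assume "A \<in> sets lborel"
    then show "(LINT t:A|lborel. Re (k t)) = (LINT t:A|lborel. 0)"
      using integral_Re[OF si[of A, unfolded set_integrable_def]] zero[of A]
      by (simp add: set_lebesgue_integral_def)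
  qed (use ik in auto)
  moreover have "AE t in lborel. Im (k t) = 0"
  proof (rule density_unique_real)
    fix A :: "real set" assume "A \<in> sets lborel"
    then show "(LINT t:A|lborel. Im (k t)) = (LINT t:A|lborel. 0)"
      using integral_Im[OF si[of A, unfolded set_integrable_def]] zero[of A]
      by (simp add: set_lebesgue_integral_def)
  qed (use ik in auto)
  ultimately show ?thesis
    by eventually_elim (simp add: complex_eq_iff)
qed

subsection \<open>Representatives of square-integrable functions\<close>

lemma L2_eq_refl: "square_integrable f \<Longrightarrow> L2_eq f f"
  by (simp add: L2_eq_def)

lemma cinner_abs_L2:
  assumes "square_integrable f" "square_integrable g"
  shows "cinner (abs_L2 f) (abs_L2 g) = (\<integral>t. f t * cnj (g t) \<partial>lborel)"
  using assms by (intro cinner_L2.abs_eq L2_eq_refl)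

lemma modulation_abs_L2:
  "square_integrable f \<Longrightarrow> modulation x (abs_L2 f) = abs_L2 (\<lambda>t. chi x t * f t)"
  unfolding chi_def by (intro modulation.abs_eq L2_eq_refl)

lemma translation_abs_L2:
  "square_integrable f \<Longrightarrow> translation x (abs_L2 f) = abs_L2 (\<lambda>t. f (t - x))"
  by (intro translation.abs_eq L2_eq_refl)

lemma square_integrable_chi_mult: "square_integrable f \<Longrightarrow> square_integrable (\<lambda>t. chi x t * f t)"
  unfolding chi_def by (rule square_integrable_modulate)

lemma square_integrable_cnj: "square_integrable f \<Longrightarrow> square_integrable (\<lambda>t. cnj (f t))"
  using borel_measurable_cnj[of f lborel] by (simp add: square_integrable_def)

lemma square_integrable_indicator_mult:
  assumes f: "square_integrable f"
  shows "square_integrable (\<lambda>t. indicator {p..<q} t * f t)"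
proof -
  note [measurable] = square_integrable_meas[OF f]
  have "integrable lborel (\<lambda>t. (cmod (indicator {p..<q} t * f t))\<^sup>2)"
    by (rule Bochner_Integration.integrable_bound[where f = "\<lambda>t. (cmod (f t))\<^sup>2"])
      (use f in \<open>auto simp: square_integrable_def indicator_def\<close>)
  then show ?thesis by (simp add: square_integrable_def)
qed

lemma square_integrable_indicator: "square_integrable (\<lambda>t. indicator {p..<q} t)"
proof -
  have "integrable lborel (indicator {p..<q} :: real \<Rightarrow> real)"
    by (intro integrable_real_indicator) (cases "p \<le> q"; simp)+
  moreover have "(cmod (indicator {p..<q} t))\<^sup>2 = indicator {p..<q} t" for t :: real
    by (simp add: indicator_def)
  ultimately show ?thesis by (simp add: square_integrable_def)
qed

lemma integral_translate:
  fixes f :: "real \<Rightarrow> complex"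
  shows "(\<integral>t. f t \<partial>lborel) = (\<integral>t. f (t + s) \<partial>lborel)"
  using lborel_integral_real_affine[of 1 f s] by (simp add: add.commute)

text \<open>For nonzero \<open>x\<close> the antiderivative \<open>F\<close> takes equal values at
  \<open>0\<close> and \<open>T\<close>, since \<open>x * T\<close> is an integer.\<close>

lemma integral_chi:
  assumes "T > 0" "x * T \<in> \<int>"
  shows "(\<integral>t. indicator {0..<T} t * chi x t \<partial>lborel) = (if x = 0 then of_real T else 0)"
proof (cases "x = 0")
  case True
  have "(\<integral>t. complex_of_real (indicator {0..<T} t) \<partial>lborel) = of_real T"
    using \<open>T > 0\<close> by (subst integral_complex_of_real) simp
  moreover have "complex_of_real (indicator {0..<T} t) = indicator {0..<T} t" for t
    by (simp add: indicator_def)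
  ultimately show ?thesis using True by simp
next
  case False
  define F where "F t = chi x t / (2 * of_real pi * \<i> * of_real x)" for t
  have "has_bochner_integral lborel (\<lambda>t. indicator {0..T} t *\<^sub>R chi x t) (F T - F 0)"
  proof (rule has_bochner_integral_FTC_Icc)
    fix t
    have "(chi x has_vector_derivative (2 * of_real pi * \<i> * of_real x) * chi x t) (at t within {0..T})"
      unfolding chi_def
      by (rule has_vector_derivative_eq_rhs)
        (auto intro!: derivative_eq_intros has_vector_derivative_real_field simp: algebra_simps)
    then have "(F has_vector_derivative (2 * of_real pi * \<i> * of_real x) * chi x t /
        (2 * of_real pi * \<i> * of_real x)) (at t within {0..T})"
      unfolding F_def by (rule has_vector_derivative_divide)
    then show "(F has_vector_derivative chi x t) (at t within {0..T})"
      using False by simp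
  qed (use \<open>T > 0\<close> continuous_chi in auto)
  moreover have "F T = F 0"
    using assms(2) by (simp add: F_def chi_eq_1_iff)
  ultimately have "(\<integral>t. indicator {0..T} t *\<^sub>R chi x t \<partial>lborel) = 0"
    by (simp add: has_bochner_integral_integral_eq)
  also have "(\<integral>t. indicator {0..T} t *\<^sub>R chi x t \<partial>lborel) = (\<integral>t. indicator {0..<T} t * chi x t \<partial>lborel)"
  proof (rule integral_cong_AE)
    show "AE t in lborel. indicator {0..T} t *\<^sub>R chi x t = indicator {0..<T} t * chi x t"
      using AE_lborel_singleton[of T] by eventually_elim (auto simp: indicator_def)
  qed measurable
  finally show ?thesis using False by simp
qed

subsection \<open>The trigonometric orthonormal system\<close>

definition trig_fun :: "real \<Rightarrow> int \<Rightarrow> real \<Rightarrow> complex" where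
  "trig_fun b m t = of_real (sqrt b) * (indicator {0..<1/b} t * chi (of_int m * b) t)"

definition trig :: "real \<Rightarrow> int \<Rightarrow> L2" where
  "trig b m = abs_L2 (trig_fun b m)"

lemma square_integrable_trig_fun: "square_integrable (trig_fun b m)"
  using square_integrable_cmult[OF square_integrable_chi_mult[OF square_integrable_indicator]]
  unfolding trig_fun_def by (simp add: mult.commute)

lemma orthonormal_trig:
  assumes "b > 0"
  shows "orthonormal_family (trig b)"
  unfolding orthonormal_family_def
proof (intro allI)
  fix m n :: int
  have "cinner (trig b m) (trig b n) = (\<integral>t. trig_fun b m t * cnj (trig_fun b n t) \<partial>lborel)"
    by (simp add: trig_def cinner_abs_L2 square_integrable_trig_fun)
  also have "\<dots> = (\<integral>t. of_real b * (indicator {0..<1/b} t * chi (of_int (m - n) * b) t) \<partial>lborel)"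
  proof (intro Bochner_Integration.integral_cong refl)
    fix t
    have "chi (of_int (m - n) * b) t = chi (of_int m * b) t * cnj (chi (of_int n * b) t)"
      by (simp add: cnj_chi left_diff_distrib flip: chi_add_left)
    moreover have "complex_of_real (sqrt b) * complex_of_real (sqrt b) = of_real b"
      using assms by (simp flip: of_real_mult)
    ultimately show "trig_fun b m t * cnj (trig_fun b n t)
        = of_real b * (indicator {0..<1/b} t * chi (of_int (m - n) * b) t)"
      by (simp add: trig_fun_def indicator_def)
  qed
  also have "\<dots> = (if m = n then 1 else 0)"
    using assms integral_chi[of "1 / b" "of_int (m - n) * b"] by simp
  finally show "cinner (trig b m) (trig b n) = (if m = n then 1 else 0)" .
qed

text \<open>The residual \<open>\<rho>\<close> of the projection has zero trigonometric
  coefficients, so it vanishes almost everywhere on the period. It is then orthogonal to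
  \<open>h\<close> as well as to the projection, hence to itself.\<close>

lemma trig_parseval:
  assumes b: "b > 0" and h: "square_integrable h" and supp: "\<And>t. t \<notin> {0..<1/b} \<Longrightarrow> h t = 0"
  shows "((\<lambda>m. cinner (abs_L2 h) (trig b m) * cinner (trig b m) y) has_sum cinner (abs_L2 h) y) UNIV"
proof -
  define x where "x = abs_L2 h"
  define W where "W = transfer_op (trig b) (trig b)"
  have on: "orthonormal_family (trig b)" and be: "bessel (trig b)"
    using orthonormal_trig[OF b] orthonormal_family_imp_bessel by auto
  obtain \<rho> where \<rho>: "square_integrable \<rho>" "x - W x = abs_L2 \<rho>"
    using L2_representatives[of "\<lambda>_. x - W x"] by metis
  have orth: "cinner (abs_L2 \<rho>) (trig b m) = 0" for m
    by (simp add: \<rho>(2)[symmetric] W_def cinner_diff_left cinner_transfer_op_base[OF be on])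
  define k where "k t = \<rho> t * cnj (indicator {0..<1/b} t)" for t
  have "null_spectrum b k"
    unfolding null_spectrum_def
  proof (intro conjI allI)
    show "integrable lborel k"
      unfolding k_def by (intro square_integrable_mult_cnj \<rho> square_integrable_indicator)
    fix m :: int
    have "0 = (\<integral>t. \<rho> t * cnj (trig_fun b (- m) t) \<partial>lborel)"
      using orth[of "- m"] by (simp add: trig_def cinner_abs_L2 \<rho>(1) square_integrable_trig_fun)
    also have "\<dots> = (\<integral>t. of_real (sqrt b) * (chi (of_int m * b) t * k t) \<partial>lborel)"
      by (intro Bochner_Integration.integral_cong refl) (simp add: trig_fun_def k_def cnj_chi)
    finally show "(\<integral>t. chi (of_int m * b) t * k t \<partial>lborel) = 0"
      using b by simp
  qed
  then have k0: "AE t in lborel. k t = 0"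
    using b by (rule null_spectrum_imp_AE_zero) (simp add: k_def)
  have "cinner (abs_L2 \<rho>) x = (\<integral>t. \<rho> t * cnj (h t) \<partial>lborel)"
    by (simp add: x_def cinner_abs_L2 \<rho> h)
  also have "\<dots> = 0"
  proof (rule integral_eq_zero_AE, use k0 in eventually_elim)
    fix t assume "k t = 0"
    then show "\<rho> t * cnj (h t) = 0"
      using supp[of t] by (auto simp: k_def indicator_def split: if_splits)
  qed
  finally have "cinner (abs_L2 \<rho>) (x - W x) = 0"
    unfolding cinner_diff_right W_def cinner_transfer_op_eq_0[OF be be orth] by simp
  then have "W x = x"
    unfolding \<rho>(2)[symmetric] by simp
  with cinner_transfer_op_has_sum[OF be be, of x y] show ?thesis
    by (simp add: W_def x_def)
qed

subsection \<open>Biorthogonality of the adjoint Gabor system\<close>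

text \<open>The intervals \<open>D n\<close> of length \<open>a\<close> partition the line;
  countable additivity is applied after enumerating the integers by
  \<open>int_decode\<close>.\<close>

lemma integral_periodization:
  fixes G :: "real \<Rightarrow> complex"
  assumes G: "integrable lborel G" and a: "a > 0"
    and S: "((\<lambda>n::int. \<integral>t. indicator {0..<a} (t + of_int n * a) * G t \<partial>lborel) has_sum S) UNIV"
  shows "(\<integral>t. G t \<partial>lborel) = S"
proof -
  define D where "D n = {t. t + of_int n * a \<in> {0..<a}}" for n :: int
  have D_iff: "t \<in> D n \<longleftrightarrow> - n = \<lfloor>t / a\<rfloor>" for t n
    using a by (auto simp: D_def eq_commute[of _ "floor _"] floor_eq_iff field_simps)
  have disj: "D (int_decode i) \<inter> D (int_decode j) = {}" if "i \<noteq> j" for i j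
    using that by (auto simp: D_iff) (metis int_decode_inverse neg_equal_iff_equal)
  have univ: "(\<Union>i. D (int_decode i)) = UNIV"
  proof (intro set_eqI iffI UNIV_I)
    fix t show "t \<in> (\<Union>i. D (int_decode i))"
      by (rule UN_I[of "int_encode (- \<lfloor>t / a\<rfloor>)"]) (simp_all add: D_iff)
  qed
  have meas: "D n \<in> sets lborel" for n
    unfolding D_def by measurable
  have eq: "(LINT t:D n|lborel. G t) = (\<integral>t. indicator {0..<a} (t + of_int n * a) * G t \<partial>lborel)" for n
    unfolding set_lebesgue_integral_def
    by (intro Bochner_Integration.integral_cong refl) (auto simp: D_def indicator_def)
  have "(LINT t:(\<Union>i. D (int_decode i))|lborel. G t) = (\<Sum>i. (LINT t:D (int_decode i)|lborel. G t))"
    using G by (intro lebesgue_integral_countable_add meas disj)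
      (auto simp: univ set_integrable_def)
  then have "(\<integral>t. G t \<partial>lborel) = (\<Sum>i. (LINT t:D (int_decode i)|lborel. G t))"
    by (simp add: univ set_lebesgue_integral_def)
  moreover have "((\<lambda>i. LINT t:D (int_decode i)|lborel. G t) has_sum S) UNIV"
    unfolding eq by (subst has_sum_reindex_bij_betw[OF bij_int_decode]) (rule S)
  then have "(\<lambda>i. LINT t:D (int_decode i)|lborel. G t) sums S"
    by (rule has_sum_imp_sums)
  ultimately show ?thesis by (simp add: sums_iff)
qed

lemma gabor_system_abs_L2:
  assumes "square_integrable \<phi>"
  shows "gabor_system a b (abs_L2 \<phi>) (m, n) = abs_L2 (\<lambda>t. chi (of_int m * b) t * \<phi> (t - of_int n * a))"
  using assms
  by (simp add: gabor_system_def translation_abs_L2 modulation_abs_L2 square_integrable_translate)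

text \<open>Testing the frame identity on two functions supported on \<open>[0, a)\<close> and \<open>[l/b, l/b + a)\<close>: since
  \<open>a < 1/b\<close>, the sum over the modulations is evaluated by Parseval's identity on a single period, and the
  sum over the translations reassembles the integral over the real line.\<close>

lemma tight_gabor_duality:
  fixes k l :: int
  assumes a: "a > 0" and b: "b > 0" and ab: "a * b < 1" and \<phi>: "square_integrable \<phi>"
    and tight: "tight_frame_bound A (gabor_system a b (abs_L2 \<phi>))"
  shows "(\<integral>t. chi (of_int k / a) t * cnj (\<phi> t) * \<phi> (t + of_int l / b) \<partial>lborel)
    = (if k = 0 \<and> l = 0 then of_real (a * b * A) else 0)"
proof -
  have a_less: "a < 1 / b" using b ab by (simp add: field_simps)
  note [measurable] = square_integrable_meas[OF \<phi>]
  have shifted: "square_integrable (\<lambda>t. \<phi> (t + s))" for s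
    using square_integrable_translate[OF \<phi>, of "- s"] by simp
  \<comment> \<open>The exponential in \<open>X\<close> will supply the character in the claim, the
    shift in \<open>Y\<close> the translate of \<open>\<phi>\<close>.\<close>
  define X where "X t = indicator {0..<a} t * chi (of_int k / a) t" for t
  define Y :: "real \<Rightarrow> complex" where "Y t = indicator {0..<a} (t - of_int l / b)" for t
  have X: "square_integrable X"
    unfolding X_def[abs_def] mult.commute[of "indicator _ _"]
    by (rule square_integrable_chi_mult[OF square_integrable_indicator])
  have Y: "square_integrable Y"
    unfolding Y_def[abs_def] by (rule square_integrable_translate[OF square_integrable_indicator])
  define g where "g = gabor_system a b (abs_L2 \<phi>)"
  \<comment> \<open>\<open>h n\<close> and \<open>h' n\<close> turn the Gabor coefficients of
    \<open>X\<close> and \<open>Y\<close> into trigonometric coefficients. For \<open>h'\<close> the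
    integrand is first moved back by \<open>l / b\<close>, which the modulations do not notice since
    \<open>m * l\<close> is an integer.\<close>
  define h where "h n t = X t * cnj (\<phi> (t - of_int n * a))" for n :: int and t
  define h' :: "int \<Rightarrow> real \<Rightarrow> complex"
    where "h' n t = indicator {0..<a} t * cnj (\<phi> (t + of_int l / b - of_int n * a))" for n t
  have h: "square_integrable (h n)" for n
  proof -
    have "square_integrable (\<lambda>t. indicator {0..<a} t * (chi (of_int k / a) t * cnj (\<phi> (t - of_int n * a))))"
      by (intro square_integrable_indicator_mult square_integrable_chi_mult square_integrable_cnj
          square_integrable_translate \<phi>)
    then show ?thesis by (simp add: h_def[abs_def] X_def mult.assoc)
  qed
  have h': "square_integrable (h' n)" for n
    using square_integrable_indicator_mult[OF square_integrable_cnj[OF shifted]]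
    by (simp add: h'_def[abs_def] add_diff_eq[symmetric])
  have supp: "h n t = 0" if "t \<notin> {0..<1/b}" for n t
    using that a_less by (auto simp: h_def X_def)
  have gmn: "g (m, n) = abs_L2 (\<lambda>t. chi (of_int m * b) t * \<phi> (t - of_int n * a))" for m n
    by (simp add: g_def gabor_system_abs_L2 \<phi>)
  have sq_g: "square_integrable (\<lambda>t. chi (of_int m * b) t * \<phi> (t - of_int n * a))" for m n :: int
    by (intro square_integrable_chi_mult square_integrable_translate \<phi>)
  have x_g: "cinner (abs_L2 (h n)) (trig b m) = of_real (sqrt b) * cinner (abs_L2 X) (g (m, n))" for m n
  proof -
    have "cinner (abs_L2 (h n)) (trig b m) = (\<integral>t. h n t * cnj (trig_fun b m t) \<partial>lborel)"
      by (simp add: trig_def cinner_abs_L2 h square_integrable_trig_fun)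
    also have "\<dots> = (\<integral>t. of_real (sqrt b) * (X t * cnj (chi (of_int m * b) t * \<phi> (t - of_int n * a))) \<partial>lborel)"
      using a_less by (intro Bochner_Integration.integral_cong refl)
        (auto simp: h_def X_def trig_fun_def indicator_def)
    also have "\<dots> = of_real (sqrt b) * cinner (abs_L2 X) (g (m, n))"
      by (simp add: gmn cinner_abs_L2 X sq_g)
    finally show ?thesis .
  qed
  have y_g: "cinner (abs_L2 (h' n)) (trig b m) = of_real (sqrt b) * cinner (abs_L2 Y) (g (m, n))" for m n
  proof -
    have "of_int m * b * (of_int l / b) = real_of_int (m * l)"
      using b by simp
    then have "chi (of_int m * b) (of_int l / b) = 1"
      by (simp add: chi_eq_1_iff del: of_int_mult)
    then have per: "chi (of_int m * b) (t + of_int l / b) = chi (of_int m * b) t" for t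
      by (simp add: chi_add_right)
    have "cinner (abs_L2 (h' n)) (trig b m) = (\<integral>t. h' n t * cnj (trig_fun b m t) \<partial>lborel)"
      by (simp add: trig_def cinner_abs_L2 h' square_integrable_trig_fun)
    also have "\<dots> = (\<integral>t. of_real (sqrt b) * (Y (t + of_int l / b) *
        cnj (chi (of_int m * b) (t + of_int l / b) * \<phi> (t + of_int l / b - of_int n * a))) \<partial>lborel)"
      unfolding per using a_less by (intro Bochner_Integration.integral_cong refl)
        (auto simp: h'_def Y_def trig_fun_def indicator_def)
    also have "\<dots> = of_real (sqrt b) *
        (\<integral>t. Y t * cnj (chi (of_int m * b) t * \<phi> (t - of_int n * a)) \<partial>lborel)"
      by (subst integral_translate[of _ "of_int l / b"]) simp
    also have "\<dots> = of_real (sqrt b) * cinner (abs_L2 Y) (g (m, n))"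
      by (simp add: gmn cinner_abs_L2 Y sq_g)
    finally show ?thesis .
  qed
  have "((\<lambda>(m, n). cinner (abs_L2 X) (g (m, n)) * cinner (g (m, n)) (abs_L2 Y)) has_sum
      of_real A * cinner (abs_L2 X) (abs_L2 Y)) (UNIV \<times> UNIV)"
    using tight_frame_polarization[OF tight] by (simp add: g_def case_prod_unfold)
  \<comment> \<open>Swapping the indices makes the modulations the inner sum.\<close>
  then have total: "((\<lambda>(n, m). cinner (abs_L2 X) (g (m, n)) * cinner (g (m, n)) (abs_L2 Y)) has_sum
      of_real A * cinner (abs_L2 X) (abs_L2 Y)) (UNIV \<times> UNIV)"
    by (subst (asm) has_sum_swap) (simp add: case_prod_unfold)
  define G where "G t = chi (of_int k / a) t * cnj (\<phi> t) * \<phi> (t + of_int l / b)" for t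
  have G: "integrable lborel G"
    using square_integrable_mult_cnj[OF square_integrable_chi_mult[OF shifted] \<phi>]
    by (simp add: G_def[abs_def] mult.assoc mult.commute[of "cnj _"])
  have inner_h: "cinner (abs_L2 (h n)) (abs_L2 (h' n))
      = (\<integral>t. indicator {0..<a} (t + of_int n * a) * G t \<partial>lborel)" for n
  proof -
    have "of_int k / a * (of_int n * a) = real_of_int (k * n)"
      using a by simp
    then have "chi (of_int k / a) (of_int n * a) = 1"
      by (simp add: chi_eq_1_iff del: of_int_mult)
    then have per: "chi (of_int k / a) (t + of_int n * a) = chi (of_int k / a) t" for t
      by (simp add: chi_add_right)
    have "cinner (abs_L2 (h n)) (abs_L2 (h' n)) = (\<integral>t. h n t * cnj (h' n t) \<partial>lborel)"
      by (simp add: cinner_abs_L2 h h')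
    also have "\<dots> = (\<integral>t. h n (t + of_int n * a) * cnj (h' n (t + of_int n * a)) \<partial>lborel)"
      by (rule integral_translate)
    also have "\<dots> = (\<integral>t. indicator {0..<a} (t + of_int n * a) * G t \<partial>lborel)"
      by (intro Bochner_Integration.integral_cong refl)
        (simp add: h_def h'_def X_def G_def per indicator_def add.commute add.left_commute)
    finally show ?thesis .
  qed
  have inner_sum: "((\<lambda>m. cinner (abs_L2 X) (g (m, n)) * cinner (g (m, n)) (abs_L2 Y)) has_sum
      (\<integral>t. indicator {0..<a} (t + of_int n * a) * G t \<partial>lborel) / of_real b) UNIV" for n
  proof -
    have "((\<lambda>m. cinner (abs_L2 (h n)) (trig b m) * cinner (trig b m) (abs_L2 (h' n)) / of_real b) has_sum
        cinner (abs_L2 (h n)) (abs_L2 (h' n)) / of_real b) UNIV"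
      by (intro has_sum_divide_const trig_parseval b h supp)
    moreover have "cinner (abs_L2 (h n)) (trig b m) * cinner (trig b m) (abs_L2 (h' n)) / of_real b
        = cinner (abs_L2 X) (g (m, n)) * cinner (g (m, n)) (abs_L2 Y)" for m
    proof -
      have "complex_of_real (sqrt b) * complex_of_real (sqrt b) = of_real b"
        using b by (simp flip: of_real_mult)
      then show ?thesis
        using b unfolding cinner_commute[of "trig b m"] cinner_commute[of "g (m, n)"] x_g y_g
        by (simp add: field_simps)
    qed
    ultimately show ?thesis by (simp add: inner_h)
  qed
  have "((\<lambda>n. (\<integral>t. indicator {0..<a} (t + of_int n * a) * G t \<partial>lborel) / of_real b) has_sum
      of_real A * cinner (abs_L2 X) (abs_L2 Y)) UNIV"
    by (rule has_sum_SigmaD[OF total]) (use inner_sum in simp)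
  from has_sum_cmult_right[OF this, of "of_real b"]
  have "((\<lambda>n. \<integral>t. indicator {0..<a} (t + of_int n * a) * G t \<partial>lborel) has_sum
      of_real b * (of_real A * cinner (abs_L2 X) (abs_L2 Y))) UNIV"
    using b by simp
  then have "(\<integral>t. G t \<partial>lborel) = of_real b * (of_real A * cinner (abs_L2 X) (abs_L2 Y))"
    by (rule integral_periodization[OF G a])
  \<comment> \<open>For \<open>l = 0\<close> a character is integrated over whole periods; otherwise
    the supports are disjoint, as they are shifted by at least \<open>1 / b\<close>, which exceeds
    \<open>a\<close>.\<close>
  also have "cinner (abs_L2 X) (abs_L2 Y) = (if k = 0 \<and> l = 0 then of_real a else 0)"
  proof (cases "l = 0")
    case True
    have "cinner (abs_L2 X) (abs_L2 Y) = (\<integral>t. indicator {0..<a} t * chi (of_int k / a) t \<partial>lborel)"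
      unfolding cinner_abs_L2[OF X Y]
      by (intro Bochner_Integration.integral_cong refl) (simp add: X_def Y_def True indicator_def)
    then show ?thesis
      using integral_chi[of a "of_int k / a"] a True by simp
  next
    case False
    have "1 / b \<le> \<bar>of_int l / b\<bar>"
      using False b by (simp add: field_simps)
    then have XY: "X t * cnj (Y t) = 0" for t
      using a_less by (auto simp: X_def Y_def indicator_def)
    then show ?thesis
      unfolding cinner_abs_L2[OF X Y] XY using False by simp
  qed
  finally show ?thesis by (simp add: G_def mult_ac)
qed

theorem theorem4p4:
  fixes a b :: real and f :: L2
  assumes "a > 0" and "b > 0" and "a * b < 1"
    and "tight_frame (gabor_system a b f)"
  shows "\<exists>u v :: int \<times> int \<Rightarrow> L2.
           orthonormal_basis u \<and> parseval_frame v \<and> \<not> orthonormal_basis v \<and>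
           weak_R_dual u v (gabor_system a b f) (adjoint_gabor_system a b f)"
proof -
  obtain A where A: "tight_frame_bound A (gabor_system a b f)"
    using assms(4) by (auto simp: tight_frame_def)
  obtain \<phi> where \<phi>: "square_integrable \<phi>" "f = abs_L2 \<phi>"
    using L2_representatives[of "\<lambda>_. f"] by metis
  note duality = tight_gabor_duality[OF assms(1-3) \<phi>(1) A[unfolded \<phi>(2)]]
  show ?thesis
  \<comment> \<open>The redundancy parameter \<open>\<rho>\<close> is \<open>a * b\<close>.\<close>
  proof (rule tight_frame_weak_R_dual[OF _ A _ _ assms(3)])
    show "infinite (UNIV :: (int \<times> int) set)"
      by (simp add: finite_prod infinite_UNIV_int)
  next
    fix i :: "int \<times> int"
    obtain m n where i: "i = (m, n)" by (cases i)
    have sq: "square_integrable (\<lambda>t. chi (of_int m * b) t * \<phi> (t - of_int n * a))"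
      by (intro square_integrable_chi_mult square_integrable_translate \<phi>(1))
    have "complex_of_real ((norm (gabor_system a b f i))\<^sup>2)
        = (\<integral>t. \<phi> (t - of_int n * a) * cnj (\<phi> (t - of_int n * a)) \<partial>lborel)"
      unfolding i \<phi>(2) gabor_system_abs_L2[OF \<phi>(1)] cinner_self[symmetric] cinner_abs_L2[OF sq sq]
    proof (intro Bochner_Integration.integral_cong refl)
      fix t
      have "chi (of_int m * b) t * cnj (chi (of_int m * b) t) = 1"
        by (simp add: complex_norm_square[symmetric])
      then show "chi (of_int m * b) t * \<phi> (t - of_int n * a) * cnj (chi (of_int m * b) t * \<phi> (t - of_int n * a))
          = \<phi> (t - of_int n * a) * cnj (\<phi> (t - of_int n * a))"
        by (simp add: mult_ac)
    qed
    also have "\<dots> = (\<integral>t. \<phi> t * cnj (\<phi> t) \<partial>lborel)"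
      by (subst integral_translate[of _ "of_int n * a"]) simp
    also have "\<dots> = of_real (a * b * A)"
      using duality[of 0 0] by (simp add: mult.commute)
    finally show "(norm (gabor_system a b f i))\<^sup>2 = a * b * A"
      by (simp only: of_real_eq_iff)
  next
    fix i j :: "int \<times> int"
    obtain m n m' n' where ij: "i = (m, n)" "j = (m', n')" by (cases i, cases j)
    define r where "r = 1 / sqrt (a * b)"
    have r: "complex_of_real r * of_real r = of_real (1 / (a * b))"
      using assms(1,2) by (simp add: r_def flip: of_real_mult)
    have sq: "square_integrable (\<lambda>t. chi (of_int m / a) t * \<phi> (t - of_int n / b))" for m n :: int
      by (intro square_integrable_chi_mult square_integrable_translate \<phi>(1))
    have w: "adjoint_gabor_system a b f (m, n) = r *\<^sub>R abs_L2 (\<lambda>t. chi (of_int m / a) t * \<phi> (t - of_int n / b))"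
      for m n
      by (simp add: adjoint_gabor_system_def r_def \<phi> translation_abs_L2 modulation_abs_L2
          square_integrable_translate)
    have "(\<integral>t. chi (of_int m / a) t * \<phi> (t - of_int n / b) *
        cnj (chi (of_int m' / a) t * \<phi> (t - of_int n' / b)) \<partial>lborel)
      = (\<integral>t. chi (of_int (m - m') / a) t * cnj (\<phi> (t - of_int n' / b)) * \<phi> (t - of_int n / b) \<partial>lborel)"
    proof (intro Bochner_Integration.integral_cong refl)
      fix t
      have "chi (of_int (m - m') / a) t = chi (of_int m / a) t * cnj (chi (of_int m' / a) t)"
        by (simp add: cnj_chi diff_divide_distrib flip: chi_add_left)
      then show "chi (of_int m / a) t * \<phi> (t - of_int n / b) *
          cnj (chi (of_int m' / a) t * \<phi> (t - of_int n' / b))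
        = chi (of_int (m - m') / a) t * cnj (\<phi> (t - of_int n' / b)) * \<phi> (t - of_int n / b)"
        by (simp add: mult_ac)
    qed
    \<comment> \<open>Translating by \<open>n' / b\<close> produces a constant phase and the duality
      integral for \<open>k = m - m'\<close> and \<open>l = n' - n\<close>. The factor
      \<open>1 / (a * b)\<close> from \<open>r\<close> finally turns \<open>a * b * A\<close> into
      \<open>A\<close>.\<close>
    also have "\<dots> = (\<integral>t. chi (of_int (m - m') / a) (of_int n' / b) *
        (chi (of_int (m - m') / a) t * cnj (\<phi> t) * \<phi> (t + of_int (n' - n) / b)) \<partial>lborel)"
      by (subst integral_translate[of _ "of_int n' / b"])
        (simp add: chi_add_right diff_divide_distrib mult_ac add_diff_eq)
    also have "\<dots> = (if i = j then of_real (a * b * A) else 0)"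
      unfolding integral_mult_right_zero duality by (simp add: ij)
    finally show "cinner (adjoint_gabor_system a b f i) (adjoint_gabor_system a b f j)
        = (if i = j then of_real A else 0)"
      using assms(1,2) r
      by (simp add: ij w cinner_scaleR_left cinner_scaleR_right cinner_abs_L2 sq mult.assoc[symmetric])
  qed
qed

end
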